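(* Let $A$ be a finite abelian group of order $2n$ with $n>1$ that contains exactly one involution $a$, and let $G=\langle A,t\rangle$ be the generalized dicyclic group, where $t^2=a$ and $t^{-1}xt=x^{-1}$ for all $x\in A$ (so $G=A\cup tA$ has order $4n$). Let $S$ be an inverse-closed subset of $G\setminus\{1\}$ such that $\langle S\rangle=G$ and there exists $s\in S$ with $\langle S\setminus\{s,s^{-1}\}\rangle\neq G$. Then the Cayley graph $\mathrm{Cay}(G,S)$ is distance-regular if and only if it is isomorphic to $K_{4,4}$, the complete bipartite graph with two parts of size $4$.
   Context: The Cayley graph $\mathrm{Cay}(G,S)$ has vertex set $G$, with distinct $g,h\in G$ adjacent if and only if $g=hs$ for some $s\in S$. A connected graph $\Gamma$ of diameter $d$ is distance-regular if for every $0\le i\le d$ and all vertices $u,v$ at distance $i$, the numbers $c_i(u,v)=|N_{i-1}(u)\cap N(v)|$, $a_i(u,v)=|N_i(u)\cap N(v)|$ and $b_i(u,v)=|N_{i+1}(u)\cap N(v)|$ depend only on $i$, where $N_j(u)$ denotes the set of vertices at distance $j$ from $u$ and $N(v)=N_1(v)$. *)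

theory Defs
  imports "HOL-Algebra.Algebra" "Graph_Theory.Graph_Theory"
begin

text \<open>
  Graphs are finite symmetric loop-free digraphs without parallel arcs, i.e. instances of the
  locale \<^locale>\<open>graph\<close>.
\<close>

definition cayley_graph :: "('g, 'm) monoid_scheme \<Rightarrow> 'g set \<Rightarrow> 'g pair_pre_digraph" where
  "cayley_graph G S = \<lparr> pverts = carrier G,
     parcs = {(g, h). g \<in> carrier G \<and> h \<in> carrier G \<and> g \<noteq> h \<and> (\<exists>s\<in>S. g = h \<otimes>\<^bsub>G\<^esub> s)} \<rparr>"

lemma pair_graph_cayley_graph:
  fixes G (structure)
  assumes "group G" "finite (carrier G)" "S \<subseteq> carrier G" "\<And>s. s \<in> S \<Longrightarrow> inv s \<in> S"
  shows "pair_graph (cayley_graph G S)"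
proof -
  interpret group G by fact
  have "parcs (cayley_graph G S) \<subseteq> carrier G \<times> carrier G"
    by (auto simp: cayley_graph_def)
  then have fin: "finite (parcs (cayley_graph G S))"
    using assms(2) finite_subset by blast
  have sym: "sym (parcs (cayley_graph G S))"
  proof (rule symI)
    fix g h assume "(g, h) \<in> parcs (cayley_graph G S)"
    then obtain s where s: "g \<in> carrier G" "h \<in> carrier G" "g \<noteq> h" "s \<in> S" "g = h \<otimes> s"
      by (auto simp: cayley_graph_def)
    then have "h = g \<otimes> inv s"
      using assms(3) by (metis inv_solve_right subsetD)
    then show "(h, g) \<in> parcs (cayley_graph G S)"
      using s assms(4) by (auto simp: cayley_graph_def)
  qed
  show ?thesis
    by unfold_locales (use assms(2) fin sym in \<open>auto simp: cayley_graph_def symmetric_def\<close>)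
qed

text \<open>Distance is the least cost of a walk when every arc has weight 1; it is \<open>\<infinity>\<close> if there
  is no walk.\<close>

definition gdist :: "('a, 'b) pre_digraph \<Rightarrow> 'a \<Rightarrow> 'a \<Rightarrow> ereal" where
  "gdist \<Gamma> u v = wf_digraph.\<mu> \<Gamma> (\<lambda>_. 1) u v"

definition gdiameter :: "('a, 'b) pre_digraph \<Rightarrow> ereal" where
  "gdiameter \<Gamma> = (SUP (u, v) \<in> verts \<Gamma> \<times> verts \<Gamma>. gdist \<Gamma> u v)"

text \<open>The index \<open>j\<close> is an integer so that the set at level \<open>i - 1\<close> is empty for \<open>i = 0\<close>.\<close>

definition dist_nbhd :: "('a, 'b) pre_digraph \<Rightarrow> int \<Rightarrow> 'a \<Rightarrow> 'a set" where
  "dist_nbhd \<Gamma> j u = {v \<in> verts \<Gamma>. gdist \<Gamma> u v = ereal (real_of_int j)}"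

definition distance_regular :: "('a, 'b) pre_digraph \<Rightarrow> bool" where
  "distance_regular \<Gamma> \<longleftrightarrow> graph \<Gamma> \<and> Digraph_Component.connected \<Gamma> \<and>
     (\<exists>d::nat. gdiameter \<Gamma> = ereal (real d) \<and>
       (\<forall>i\<le>d. \<exists>c a b :: nat. \<forall>u\<in>verts \<Gamma>. \<forall>v\<in>verts \<Gamma>. gdist \<Gamma> u v = ereal (real i) \<longrightarrow>
          card (dist_nbhd \<Gamma> (int i - 1) u \<inter> dist_nbhd \<Gamma> 1 v) = c \<and>
          card (dist_nbhd \<Gamma> (int i) u \<inter> dist_nbhd \<Gamma> 1 v) = a \<and>
          card (dist_nbhd \<Gamma> (int i + 1) u \<inter> dist_nbhd \<Gamma> 1 v) = b))"

definition complete_bipartite_graph :: "nat \<Rightarrow> nat \<Rightarrow> (nat + nat) pair_pre_digraph" where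
  "complete_bipartite_graph m n = \<lparr> pverts = {..<m} <+> {..<n},
     parcs = (Inl ` {..<m}) \<times> (Inr ` {..<n}) \<union> (Inr ` {..<n}) \<times> (Inl ` {..<m}) \<rparr>"

lemma complete_bipartite_digraph_complete_bipartite_graph:
  "complete_bipartite_digraph m n (with_proj (complete_bipartite_graph m n))"
proof -
  have "card (Inl ` {..<m} :: (nat + nat) set) = m" "card (Inr ` {..<n} :: (nat + nat) set) = n"
    by (simp_all add: card_image)
  then show ?thesis
    unfolding complete_bipartite_digraph_pair_def complete_bipartite_graph_def Plus_def
    by (intro conjI exI[of _ "Inl ` {..<m}"] exI[of _ "Inr ` {..<n}"]) auto
qed

end

theory Submission
  imports Defs
begin

text \<open>
  Let \<open>H = \<langle>S - {s, s\<^sup>-\<^sup>1}\<rangle>\<close>, so that \<open>s \<notin> H\<close>, and for \<open>z \<in> G\<close> let \<open>T z\<close> be the set of common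
  neighbours of \<open>1\<close> and \<open>z\<close>, i.e. of the \<open>y \<in> S\<close> with \<open>z \<in> y S\<close>. Distance-regularity makes \<open>card (T z)\<close>
  constant on \<open>S\<close> (value \<open>\<lambda> = a\<^sub>1\<close>) and on the vertices at distance 2 (value \<open>\<mu> = c\<^sub>2\<close>). Only \<open>s\<close> and
  its inverse leave the left cosets of \<open>H\<close>, which forces \<open>T s \<subseteq> {s\<^sup>2, s\<^sup>-\<^sup>1}\<close> and
  \<open>T (s x) \<subseteq> {s, s\<^sup>-\<^sup>1, s x s\<^sup>-\<^sup>1, s x s}\<close> for \<open>x \<in> S \<inter> H\<close>; hence \<open>\<lambda> \<le> 2\<close> and \<open>\<mu> \<le> 4\<close>. The relations
  \<open>g\<^sup>2 = a\<close> and \<open>g x = x\<^sup>-\<^sup>1 g\<close> for \<open>g \<notin> A\<close>, \<open>x \<in> A\<close> even give \<open>\<mu> \<in> {2, 4}\<close>. On the other hand every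
  element of \<open>S - A\<close> is a common neighbour of \<open>1\<close> and \<open>a\<close>, which bounds \<open>card (S - A)\<close>. Playing
  these counts (mostly for \<open>T a\<close> and \<open>T (s\<^sup>2)\<close>) against each other rules out \<open>\<mu> = 2\<close> and leaves
  \<open>card S = 4\<close>, \<open>\<lambda> = 0\<close>, \<open>\<mu> = 4\<close>. Then \<open>S S S = S\<close>, so \<open>S S\<close> and \<open>S\<close> are the two parts of a
  complete bipartite graph.
\<close>

section \<open>Distances in digraphs and complete bipartite graphs\<close>

context wf_digraph
begin

lemma gdist_le_length:
  assumes "awalk u p v"
  shows "gdist G u v \<le> ereal (real (length p))"
proof -
  have "awalk_cost (\<lambda>_. 1) q = real (length q)" for q
    by (induction q) auto
  then show ?thesis
    using min_cost_le_walk_cost[OF assms, of "\<lambda>_. 1"] by (simp add: gdist_def)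
qed

lemma gdist_geI:
  assumes "\<And>p. awalk u p v \<Longrightarrow> n \<le> length p"
  shows "ereal (real n) \<le> gdist G u v"
proof -
  have "awalk_cost (\<lambda>_. 1) q = real (length q)" for q
    by (induction q) auto
  then show ?thesis
    using assms unfolding gdist_def \<mu>_def by (auto intro!: INF_greatest)
qed

text \<open>Walk lengths are natural numbers, so a finite infimum is attained: if no walk had length
  \<open>n\<close>, then \<open>Suc n\<close> would still be a lower bound.\<close>

lemma gdist_eq_iff:
  "gdist G u v = ereal (real n) \<longleftrightarrow>
    (\<exists>p. awalk u p v \<and> length p = n) \<and> (\<forall>p. awalk u p v \<longrightarrow> n \<le> length p)"
proof (intro iffI conjI)
  assume L: "gdist G u v = ereal (real n)"
  show ge: "\<forall>p. awalk u p v \<longrightarrow> n \<le> length p"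
    using gdist_le_length L by fastforce
  show "\<exists>p. awalk u p v \<and> length p = n"
  proof (rule ccontr)
    assume "\<not> ?thesis"
    then have "ereal (real (Suc n)) \<le> gdist G u v"
      using ge by (intro gdist_geI) (metis Suc_leI le_neq_implies_less)
    then show False using L by simp
  qed
next
  assume "(\<exists>p. awalk u p v \<and> length p = n) \<and> (\<forall>p. awalk u p v \<longrightarrow> n \<le> length p)"
  then show "gdist G u v = ereal (real n)"
    using gdist_le_length gdist_geI by (metis antisym)
qed

lemma awalk_length_0: "(\<exists>p. awalk u p v \<and> length p = 0) \<longleftrightarrow> u \<in> verts G \<and> u = v"
  by (auto simp: awalk_Nil_iff)

lemma awalk_length_1: "(\<exists>p. awalk u p v \<and> length p = 1) \<longleftrightarrow> u \<rightarrow> v"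
proof
  assume "\<exists>p. awalk u p v \<and> length p = 1"
  then obtain p where p: "awalk u p v" "length p = 1" by blast
  from p(2) obtain e where "p = [e]" by (auto simp: length_Suc_conv)
  with p(1) show "u \<rightarrow> v" by (force simp: awalk_simps arcs_ends_conv)
next
  assume "u \<rightarrow> v"
  then obtain e where "e \<in> arcs G" "tail G e = u" "head G e = v" by (rule reachableE)
  then have "awalk u [e] v \<and> length [e] = 1" by (auto simp: awalk_simps)
  then show "\<exists>p. awalk u p v \<and> length p = 1" by blast
qed

lemma awalk_length_2: "(\<exists>p. awalk u p v \<and> length p = 2) \<longleftrightarrow> (\<exists>w. u \<rightarrow> w \<and> w \<rightarrow> v)"
proof
  assume "\<exists>p. awalk u p v \<and> length p = 2"
  then obtain p where p: "awalk u p v" "length p = 2" by blast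
  from p(2) obtain e f where "p = [e, f]" by (auto simp: length_Suc_conv numeral_2_eq_2)
  with p(1) have "u \<rightarrow> head G e" "head G e \<rightarrow> v" by (force simp: awalk_simps arcs_ends_conv)+
  then show "\<exists>w. u \<rightarrow> w \<and> w \<rightarrow> v" by blast
next
  assume "\<exists>w. u \<rightarrow> w \<and> w \<rightarrow> v"
  then obtain w where w: "u \<rightarrow> w" "w \<rightarrow> v" by blast
  obtain e where "e \<in> arcs G" "tail G e = u" "head G e = w" using w(1) by (rule reachableE)
  moreover obtain f where "f \<in> arcs G" "tail G f = w" "head G f = v" using w(2) by (rule reachableE)
  ultimately have "awalk u [e, f] v \<and> length [e, f] = 2" by (auto simp: awalk_simps)
  then show "\<exists>p. awalk u p v \<and> length p = 2" by blast
qed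

lemma gdist_eq_0_iff: "gdist G u v = 0 \<longleftrightarrow> u \<in> verts G \<and> u = v"
  using gdist_eq_iff[of u v 0] awalk_length_0[of u v] by (simp flip: zero_ereal_def) 

lemma gdist_eq_1_iff: "gdist G u v = 1 \<longleftrightarrow> u \<noteq> v \<and> u \<rightarrow> v"
proof -
  have "(\<forall>p. awalk u p v \<longrightarrow> 1 \<le> length p) \<longleftrightarrow> \<not> (u \<in> verts G \<and> u = v)"
    unfolding awalk_length_0[symmetric] by (auto simp: Suc_le_eq)
  then show ?thesis
    using gdist_eq_iff[of u v 1] unfolding awalk_length_1 by (auto dest: adj_in_verts)
qed

lemma gdist_eq_2_iff: "gdist G u v = ereal 2 \<longleftrightarrow> u \<noteq> v \<and> \<not> u \<rightarrow> v \<and> (\<exists>w. u \<rightarrow> w \<and> w \<rightarrow> v)"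
proof -
  have "(\<forall>p. awalk u p v \<longrightarrow> 2 \<le> length p) \<longleftrightarrow> \<not> (u \<in> verts G \<and> u = v) \<and> \<not> u \<rightarrow> v"
    unfolding awalk_length_0[symmetric] awalk_length_1[symmetric]
    by (metis One_nat_def Suc_1 Suc_leI le_0_eq less_2_cases_iff not_less)
  then show ?thesis
    using gdist_eq_iff[of u v 2] unfolding awalk_length_2 by (auto dest: adj_in_verts)
qed

end

text \<open>Trades the isomorphism for a partition of the vertex set, the form in which it is both
  produced and exploited later.\<close>

lemma digraph_iso_complete_bipartite_iff:
  fixes \<Gamma> :: "'a pair_pre_digraph"
  shows "digraph_iso (with_proj \<Gamma>) (with_proj (complete_bipartite_graph m n)) \<longleftrightarrow>
    (\<exists>P Q. finite P \<and> finite Q \<and> card P = m \<and> card Q = n \<and> P \<inter> Q = {} \<and> pverts \<Gamma> = P \<union> Q \<and>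
      parcs \<Gamma> = P \<times> Q \<union> Q \<times> P)" (is "?L \<longleftrightarrow> ?R")
proof
  let ?K = "complete_bipartite_graph m n"
  assume ?L
  then obtain f where f: "pre_digraph.digraph_isomorphism (with_proj \<Gamma>) f"
    and K: "with_proj ?K = app_iso f (with_proj \<Gamma>)"
    by (auto simp: digraph_iso_def)
  define h where "h = iso_verts f"
  have inj: "inj_on h (pverts \<Gamma>)" and wf: "wf_digraph (with_proj \<Gamma>)"
    using f by (auto simp: pre_digraph.digraph_isomorphism_def h_def)
  have V: "h ` pverts \<Gamma> = Inl ` {..<m} \<union> Inr ` {..<n}"
    using arg_cong[OF K, of verts] by (simp add: h_def complete_bipartite_graph_def Plus_def)
  \<comment> \<open>Arcs of the target are pairs with the projections as tail and head. This fixes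
    two components of \<open>f\<close>, and the arc map is then forced to be
    \<open>map_prod h h\<close>.\<close>
  have ht: "iso_tail f = fst" "iso_head f = snd"
    using arg_cong[OF K, of tail] arg_cong[OF K, of head] by simp_all
  have ar: "iso_arcs f e = map_prod h h e" if "e \<in> parcs \<Gamma>" for e
    using f that by (auto simp: pre_digraph.digraph_isomorphism_def ht h_def map_prod_def split: prod.split intro!: prod_eqI)
  have A: "map_prod h h ` parcs \<Gamma> = parcs ?K"
    using arg_cong[OF K, of arcs] ar by simp
  have sub: "parcs \<Gamma> \<subseteq> pverts \<Gamma> \<times> pverts \<Gamma>"
    using wf_digraph.tail_in_verts[OF wf] wf_digraph.head_in_verts[OF wf] by fastforce
  have arc_iff: "(u, v) \<in> parcs \<Gamma> \<longleftrightarrow> (h u, h v) \<in> parcs ?K" if "u \<in> pverts \<Gamma>" "v \<in> pverts \<Gamma>" for u v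
  proof
    assume "(h u, h v) \<in> parcs ?K"
    then obtain x y where xy: "(x, y) \<in> parcs \<Gamma>" "h u = h x" "h v = h y"
      unfolding A[symmetric] by auto
    then have "u = x" "v = y" using that sub by (auto intro: inj_onD[OF inj])
    then show "(u, v) \<in> parcs \<Gamma>" using xy by simp
  qed (force simp flip: A)
  define P where "P = {v \<in> pverts \<Gamma>. h v \<in> Inl ` {..<m}}"
  define Q where "Q = {v \<in> pverts \<Gamma>. h v \<in> Inr ` {..<n}}"
  have image_Collect_mem: "h ` {v \<in> pverts \<Gamma>. h v \<in> I} = I" if "I \<subseteq> h ` pverts \<Gamma>" for I
    using that by auto
  have PQ: "h ` P = Inl ` {..<m}" "h ` Q = Inr ` {..<n}"
    unfolding P_def Q_def by (rule image_Collect_mem, simp add: V)+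
  have injs: "inj_on h P" "inj_on h Q"
    using inj by (auto simp: P_def Q_def inj_on_def)
  have "finite P" "finite Q" "card P = m" "card Q = n"
    using PQ finite_imageD[OF _ injs(1)] finite_imageD[OF _ injs(2)]
      card_image[OF injs(1)] card_image[OF injs(2)] by (simp_all add: card_image)
  moreover have "P \<inter> Q = {}" by (auto simp: P_def Q_def)
  moreover have PU: "pverts \<Gamma> = P \<union> Q" using V by (auto simp: P_def Q_def)
  moreover have "parcs \<Gamma> = P \<times> Q \<union> Q \<times> P"
  proof -
    have "(u, v) \<in> parcs \<Gamma> \<longleftrightarrow> (u, v) \<in> P \<times> Q \<union> Q \<times> P" for u v
    proof (cases "u \<in> pverts \<Gamma> \<and> v \<in> pverts \<Gamma>")
      case True
      then show ?thesis
        by (simp add: arc_iff) (auto simp: complete_bipartite_graph_def P_def Q_def)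
    next
      case False
      then show ?thesis using sub by (auto simp: P_def Q_def)
    qed
    then show ?thesis by auto
  qed
  ultimately show ?R by blast
next
  assume ?R
  then obtain P Q where fin: "finite P" "finite Q" and c: "card P = m" "card Q = n"
    and d: "P \<inter> Q = {}" and V: "pverts \<Gamma> = P \<union> Q" and A: "parcs \<Gamma> = P \<times> Q \<union> Q \<times> P"
    by blast
  obtain p q where p: "bij_betw p P {..<m}" and q: "bij_betw q Q {..<n}"
    using fin c by (metis ex_bij_betw_finite_nat atLeast0LessThan)
  define h where "h v = (if v \<in> P then Inl (p v) else Inr (q v))" for v
  define f where "f = \<lparr> iso_verts = h, iso_arcs = map_prod h h, iso_head = snd, iso_tail = fst \<rparr>"
  have hP: "h ` P = Inl ` {..<m}" "h ` Q = Inr ` {..<n}"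
  proof -
    have "h ` P = Inl ` p ` P" by (force simp: h_def)
    moreover have "h ` Q = Inr ` q ` Q" using d by (force simp: h_def)
    ultimately show "h ` P = Inl ` {..<m}" "h ` Q = Inr ` {..<n}"
      using p q by (simp_all add: bij_betw_def)
  qed
  have inj: "inj_on h (pverts \<Gamma>)"
    using p q d by (auto simp: V h_def inj_on_def bij_betw_def)
  have sub: "parcs \<Gamma> \<subseteq> pverts \<Gamma> \<times> pverts \<Gamma>" by (auto simp: V A)
  have "wf_digraph (with_proj \<Gamma>)"
    by unfold_locales (use sub in auto)
  then have "pre_digraph.digraph_isomorphism (with_proj \<Gamma>) f"
    using inj sub by (auto simp: pre_digraph.digraph_isomorphism_def f_def intro: inj_on_subset map_prod_inj_on)
  moreover have "with_proj (complete_bipartite_graph m n) = app_iso f (with_proj \<Gamma>)"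
  proof -
    have "map_prod h h ` (P \<times> Q \<union> Q \<times> P) = (h ` P) \<times> (h ` Q) \<union> (h ` Q) \<times> (h ` P)"
      by (simp add: image_Un map_prod_surj_on[OF refl refl])
    then show ?thesis
      by (simp add: with_proj_def app_iso_def f_def complete_bipartite_graph_def V A hP image_Un Plus_def)
  qed
  ultimately show ?L by (auto simp: digraph_iso_def)
qed

text \<open>The triples c, a, b are 0, 0, n at distance 0, then 1, 0, n - 1 at distance 1, and n, 0,
  0 at distance 2. The bound \<open>n \<ge> 2\<close> supplies two distinct vertices in one part,
  which makes the diameter exactly 2.\<close>

lemma distance_regular_complete_bipartite:
  fixes \<Gamma> :: "'a pair_pre_digraph"
  assumes fin: "finite P" "finite Q" and c: "card P = n" "card Q = n" and n: "n \<ge> 2"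
    and d: "P \<inter> Q = {}" and V: "pverts \<Gamma> = P \<union> Q" and A: "parcs \<Gamma> = P \<times> Q \<union> Q \<times> P"
  shows "distance_regular (with_proj \<Gamma>)"
proof -
  interpret pair_graph \<Gamma>
    by unfold_locales (use fin d in \<open>auto simp: V A symmetric_def sym_def\<close>)
  have ne: "P \<noteq> {}" "Q \<noteq> {}" using c n by auto
  have d1: "gdist \<Gamma> u v = 1 \<longleftrightarrow> (u, v) \<in> P \<times> Q \<union> Q \<times> P" for u v
    using d by (auto simp: gdist_eq_1_iff A)
  have d2: "gdist \<Gamma> u v = ereal 2 \<longleftrightarrow> u \<noteq> v \<and> (u, v) \<in> P \<times> P \<union> Q \<times> Q" for u v
    using d ne by (auto simp: gdist_eq_2_iff A)
  have d0: "gdist \<Gamma> u v = 0 \<longleftrightarrow> u \<in> P \<union> Q \<and> u = v" for u v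
    by (auto simp: gdist_eq_0_iff V)
  have d012: "gdist \<Gamma> u v \<in> {0, 1, ereal 2}" if "u \<in> P \<union> Q" "v \<in> P \<union> Q" for u v
    using that d0[of u v] d1[of u v] d2[of u v] by auto
  have ex2: "\<exists>u\<in>P. \<exists>v\<in>P. u \<noteq> v"
    by (rule ccontr) (use card_le_Suc0_iff_eq[OF fin(1)] c n in auto)
  have diam: "gdiameter \<Gamma> = ereal (real 2)"
    unfolding gdiameter_def
  proof (rule SUP_eqI)
    fix uv assume "uv \<in> verts \<Gamma> \<times> verts \<Gamma>"
    then have "gdist \<Gamma> (fst uv) (snd uv) \<in> {0, 1, ereal 2}" by (intro d012) (auto simp: V)
    then show "(case uv of (u, v) \<Rightarrow> gdist \<Gamma> u v) \<le> ereal (real 2)"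
      by (auto simp: case_prod_beta)
  next
    fix y assume y: "\<And>uv. uv \<in> verts \<Gamma> \<times> verts \<Gamma> \<Longrightarrow> (case uv of (u, v) \<Rightarrow> gdist \<Gamma> u v) \<le> y"
    obtain u v where "u \<in> P" "v \<in> P" "u \<noteq> v" using ex2 by blast
    then show "ereal (real 2) \<le> y" using y[of "(u, v)"] d2[of u v] by (simp add: V)
  qed
  define opp where "opp v = (if v \<in> P then Q else P)" for v
  have N0: "dist_nbhd \<Gamma> 0 u = {u}" if "u \<in> P \<union> Q" for u
    using that by (auto simp: dist_nbhd_def d0 V simp flip: zero_ereal_def)
  have N1: "dist_nbhd \<Gamma> 1 u = opp u" if "u \<in> P \<union> Q" for u
    using that d by (auto simp: dist_nbhd_def d1 V opp_def simp flip: one_ereal_def)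
  have N2: "dist_nbhd \<Gamma> 2 u = P \<union> Q - opp u - {u}" if "u \<in> P \<union> Q" for u
    using that d by (auto simp: dist_nbhd_def d2 V opp_def)
  \<comment> \<open>These levels arise as \<open>i - 1\<close> for \<open>i = 0\<close> and as
    \<open>i + 1\<close> for \<open>i = 2\<close>.\<close>
  have N3: "dist_nbhd \<Gamma> (-1) u = {}" "dist_nbhd \<Gamma> 3 u = {}" if "u \<in> P \<union> Q" for u
    using d012[OF that] by (fastforce simp: dist_nbhd_def V)+
  have opp: "card (opp v) = n" for v using c by (simp add: opp_def)
  \<comment> \<open>\<open>connected\<close> refers to the symmetric closure, which is
    \<open>\<Gamma>\<close> itself because its arcs come in opposite pairs.\<close>
  have "mk_symmetric (with_proj \<Gamma>) = \<Gamma>"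
    by (intro pair_pre_digraph.equality) (force simp: mk_symmetric_def V A)+
  moreover have "strongly_connected \<Gamma>"
  proof (rule strongly_connectedI)
    fix u v assume uv: "u \<in> verts \<Gamma>" "v \<in> verts \<Gamma>"
    show "u \<rightarrow>\<^sup>*\<^bsub>with_proj \<Gamma>\<^esub> v"
    proof (cases "(u, v) \<in> parcs \<Gamma>")
      case False
      obtain w where "(u, w) \<in> parcs \<Gamma>" "(w, v) \<in> parcs \<Gamma>"
        using False uv ne by (auto simp: V A)
      then show ?thesis by (metis adj_reachable_trans reachable_adjI with_proj_simps(3))
    qed auto
  qed (use ne in \<open>simp add: V\<close>)
  ultimately have con: "Digraph_Component.connected \<Gamma>"
    by (simp add: connected_def)
  have "\<exists>c a b :: nat. \<forall>u\<in>verts \<Gamma>. \<forall>v\<in>verts \<Gamma>. gdist \<Gamma> u v = ereal (real i) \<longrightarrow>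
          card (dist_nbhd \<Gamma> (int i - 1) u \<inter> dist_nbhd \<Gamma> 1 v) = c \<and>
          card (dist_nbhd \<Gamma> (int i) u \<inter> dist_nbhd \<Gamma> 1 v) = a \<and>
          card (dist_nbhd \<Gamma> (int i + 1) u \<inter> dist_nbhd \<Gamma> 1 v) = b" if "i \<le> 2" for i
  proof -
    consider "i = 0" | "i = 1" | "i = 2" using \<open>i \<le> 2\<close> by linarith
    then show ?thesis
    proof cases
      case 1
      have "card (dist_nbhd \<Gamma> (-1) u \<inter> dist_nbhd \<Gamma> 1 v) = 0 \<and>
          card (dist_nbhd \<Gamma> 0 u \<inter> dist_nbhd \<Gamma> 1 v) = 0 \<and>
          card (dist_nbhd \<Gamma> 1 u \<inter> dist_nbhd \<Gamma> 1 v) = n"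
        if "u \<in> P \<union> Q" "v \<in> P \<union> Q" "gdist \<Gamma> u v = 0" for u v
      proof -
        have "v \<notin> opp v" using d that by (auto simp: opp_def)
        then show ?thesis using that unfolding d0 by (auto simp: N0 N1 N3 opp)
      qed
      then show ?thesis using 1 by (simp add: V flip: zero_ereal_def; blast)
    next
      case 2
      have "card (dist_nbhd \<Gamma> 0 u \<inter> dist_nbhd \<Gamma> 1 v) = 1 \<and>
          card (dist_nbhd \<Gamma> 1 u \<inter> dist_nbhd \<Gamma> 1 v) = 0 \<and>
          card (dist_nbhd \<Gamma> 2 u \<inter> dist_nbhd \<Gamma> 1 v) = n - 1"
        if "u \<in> P \<union> Q" "v \<in> P \<union> Q" "gdist \<Gamma> u v = 1" for u v
      proof -
        have "u \<in> opp v" "opp u \<inter> opp v = {}" "(P \<union> Q - opp u - {u}) \<inter> opp v = opp v - {u}"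
          using that d unfolding d1 opp_def by (auto split: if_splits)
        then show ?thesis using that opp[of v] by (simp add: N0 N1 N2)
      qed
      then show ?thesis using 2 by (simp add: V flip: one_ereal_def; blast)
    next
      case 3
      have "card (dist_nbhd \<Gamma> 1 u \<inter> dist_nbhd \<Gamma> 1 v) = n \<and>
          card (dist_nbhd \<Gamma> 2 u \<inter> dist_nbhd \<Gamma> 1 v) = 0 \<and>
          card (dist_nbhd \<Gamma> 3 u \<inter> dist_nbhd \<Gamma> 1 v) = 0"
        if "u \<in> P \<union> Q" "v \<in> P \<union> Q" "gdist \<Gamma> u v = ereal 2" for u v
      proof -
        have "opp u = opp v" using that d unfolding d2 opp_def by (auto split: if_splits)
        moreover have "(P \<union> Q - opp v - {u}) \<inter> opp v = {}" by auto
        ultimately show ?thesis using that opp[of v] by (simp add: N1 N2 N3)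
      qed
      then show ?thesis using 3 by (simp add: V; blast)
    qed
  qed
  then show ?thesis
    unfolding distance_regular_def using con diam pair_graphD_graph by blast
qed

section \<open>Cayley graphs\<close>

lemma (in group) cayley_graph_arc_iff:
  assumes "S \<subseteq> carrier G - {\<one>}"
  shows "(g, h) \<in> parcs (cayley_graph G S) \<longleftrightarrow> g \<in> carrier G \<and> h \<in> carrier G \<and> inv h \<otimes> g \<in> S"
proof -
  have "g \<noteq> h \<and> (\<exists>s\<in>S. g = h \<otimes> s) \<longleftrightarrow> inv h \<otimes> g \<in> S" if gh: "g \<in> carrier G" "h \<in> carrier G"
  proof
    assume "g \<noteq> h \<and> (\<exists>s\<in>S. g = h \<otimes> s)"
    then show "inv h \<otimes> g \<in> S" using gh assms by (auto simp flip: m_assoc)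
  next
    assume S: "inv h \<otimes> g \<in> S"
    have "g = h \<otimes> (inv h \<otimes> g)" using gh by (simp flip: m_assoc)
    moreover have "g \<noteq> h" using S gh assms by auto
    ultimately show "g \<noteq> h \<and> (\<exists>s\<in>S. g = h \<otimes> s)" using S by blast
  qed
  then show ?thesis by (auto simp: cayley_graph_def)
qed

text \<open>With \<one> as base vertex, the common neighbours of \<one> and \<open>z\<close> are the
  first factors in factorisations of \<open>z\<close> into two elements of \<open>S\<close>. The
  witnesses are the intersection numbers a_1 and c_2 as far as the diameter reaches.\<close>

lemma (in group) cayley_graph_distance_regular_common_neighbours:
  assumes fin: "finite (carrier G)" and S: "S \<subseteq> carrier G - {\<one>}" and S_inv: "\<And>s. s \<in> S \<Longrightarrow> inv s \<in> S"
    and dr: "distance_regular (with_proj (cayley_graph G S))"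
  obtains l m :: nat
  where "\<And>x. x \<in> S \<Longrightarrow> card {y \<in> S. \<exists>u\<in>S. y \<otimes> u = x} = l"
    and "\<And>x y. x \<in> S \<Longrightarrow> y \<in> S \<Longrightarrow> x \<otimes> y \<notin> S \<Longrightarrow> x \<otimes> y \<noteq> \<one> \<Longrightarrow>
      card {v \<in> S. \<exists>u\<in>S. v \<otimes> u = x \<otimes> y} = m"
proof -
  define \<Gamma> where "\<Gamma> = cayley_graph G S"
  interpret pair_graph \<Gamma>
    unfolding \<Gamma>_def using S S_inv fin is_group by (intro pair_graph_cayley_graph) auto
  have SC: "x \<in> carrier G" if "x \<in> S" for x using S that by auto
  have verts: "pverts \<Gamma> = carrier G" by (simp add: \<Gamma>_def cayley_graph_def)
  have arc: "(g, h) \<in> parcs \<Gamma> \<longleftrightarrow> g \<in> carrier G \<and> h \<in> carrier G \<and> inv h \<otimes> g \<in> S" for g h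
    unfolding \<Gamma>_def by (rule cayley_graph_arc_iff[OF S])
  have arc_one: "(\<one>, x) \<in> parcs \<Gamma> \<longleftrightarrow> x \<in> S" for x
    using S_inv SC by (auto simp: arc) (metis inv_inv)
  have N1: "dist_nbhd \<Gamma> 1 v = {y. (v, y) \<in> parcs \<Gamma>}" for v
    using S by (auto simp: dist_nbhd_def gdist_eq_1_iff verts arc simp flip: one_ereal_def)
  have common: "dist_nbhd \<Gamma> 1 \<one> \<inter> dist_nbhd \<Gamma> 1 v = {y \<in> S. \<exists>u\<in>S. y \<otimes> u = v}"
    if v: "v \<in> carrier G" for v
  proof -
    have "inv y \<otimes> v \<in> S \<longleftrightarrow> (\<exists>u\<in>S. y \<otimes> u = v)" if y: "y \<in> S" for y
    proof
      assume "inv y \<otimes> v \<in> S"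
      moreover have "y \<otimes> (inv y \<otimes> v) = v" using SC[OF y] v by (simp flip: m_assoc)
      ultimately show "\<exists>u\<in>S. y \<otimes> u = v" by blast
    next
      assume "\<exists>u\<in>S. y \<otimes> u = v"
      then show "inv y \<otimes> v \<in> S" using SC[OF y] SC by (auto simp flip: m_assoc)
    qed
    then show ?thesis using v by (simp add: N1 arc_one) (auto simp: arc SC)
  qed
  obtain d :: nat where diam: "gdiameter \<Gamma> = ereal (real d)"
    and reg: "\<And>i. i \<le> d \<Longrightarrow> \<exists>c a b :: nat. \<forall>u\<in>verts \<Gamma>. \<forall>v\<in>verts \<Gamma>. gdist \<Gamma> u v = ereal (real i) \<longrightarrow>
          card (dist_nbhd \<Gamma> (int i - 1) u \<inter> dist_nbhd \<Gamma> 1 v) = c \<and>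
          card (dist_nbhd \<Gamma> (int i) u \<inter> dist_nbhd \<Gamma> 1 v) = a \<and>
          card (dist_nbhd \<Gamma> (int i + 1) u \<inter> dist_nbhd \<Gamma> 1 v) = b"
    using dr unfolding distance_regular_def \<Gamma>_def by blast
  have reg_one: "\<exists>c a. \<forall>v\<in>carrier G. gdist \<Gamma> \<one> v = ereal (real i) \<longrightarrow>
      card (dist_nbhd \<Gamma> (int i - 1) \<one> \<inter> dist_nbhd \<Gamma> 1 v) = c \<and>
      card (dist_nbhd \<Gamma> (int i) \<one> \<inter> dist_nbhd \<Gamma> 1 v) = a" if i: "i \<le> d" for i
  proof -
    obtain c a b :: nat where "\<forall>u\<in>verts \<Gamma>. \<forall>v\<in>verts \<Gamma>. gdist \<Gamma> u v = ereal (real i) \<longrightarrow>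
          card (dist_nbhd \<Gamma> (int i - 1) u \<inter> dist_nbhd \<Gamma> 1 v) = c \<and>
          card (dist_nbhd \<Gamma> (int i) u \<inter> dist_nbhd \<Gamma> 1 v) = a \<and>
          card (dist_nbhd \<Gamma> (int i + 1) u \<inter> dist_nbhd \<Gamma> 1 v) = b"
      using reg[OF i] by blast
    from bspec[OF this, of \<one>] show ?thesis by (simp add: verts; blast)
  qed
  have le_d: "i \<le> d" if "v \<in> carrier G" "gdist \<Gamma> \<one> v = ereal (real i)" for i v
  proof -
    have "gdist \<Gamma> \<one> v \<le> gdiameter \<Gamma>"
      unfolding gdiameter_def using that by (intro SUP_upper2[of "(\<one>, v)"]) (auto simp: verts)
    then show ?thesis using that diam by simp
  qed
  have "\<exists>l. \<forall>x\<in>S. card {y \<in> S. \<exists>u\<in>S. y \<otimes> u = x} = l"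
  proof (cases "1 \<le> d")
    case True
    obtain l where l: "\<forall>v\<in>carrier G. gdist \<Gamma> \<one> v = 1 \<longrightarrow> card (dist_nbhd \<Gamma> 1 \<one> \<inter> dist_nbhd \<Gamma> 1 v) = l"
      using reg_one[OF True] by (simp flip: one_ereal_def; blast)
    have g1: "gdist \<Gamma> \<one> x = 1" if "x \<in> S" for x
      using that S by (auto simp: gdist_eq_1_iff arc_one)
    have "card {y \<in> S. \<exists>u\<in>S. y \<otimes> u = x} = l" if "x \<in> S" for x
      using bspec[OF l SC[OF that]] common[OF SC[OF that]] g1[OF that] by simp
    then show ?thesis by blast
  next
    \<comment> \<open>Every element of \<open>S\<close> is at distance 1 from \<one>, so here
      \<open>S\<close> is empty and any \<open>l\<close> will do. The choice of \<open>m\<close> for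
      diameter below 2 is vacuous in the same way.\<close>
    case False
    have "gdist \<Gamma> \<one> x = ereal (real 1)" if "x \<in> S" for x
      using that S by (auto simp: gdist_eq_1_iff arc_one simp flip: one_ereal_def)
    then show ?thesis using le_d SC False by blast
  qed
  then obtain l where l: "\<And>x. x \<in> S \<Longrightarrow> card {y \<in> S. \<exists>u\<in>S. y \<otimes> u = x} = l" by blast
  have dist2: "gdist \<Gamma> \<one> (x \<otimes> y) = ereal (real 2)"
    if "x \<in> S" "y \<in> S" "x \<otimes> y \<notin> S" "x \<otimes> y \<noteq> \<one>" for x y
  proof -
    have "(\<one>, x) \<in> parcs \<Gamma>" using that arc_one by simp
    moreover have "(x, x \<otimes> y) \<in> parcs \<Gamma>"
      using that SC S_inv by (simp add: arc inv_mult_group m_assoc)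
    ultimately have "gdist \<Gamma> \<one> (x \<otimes> y) = ereal 2"
      using that arc_one by (auto simp: gdist_eq_2_iff)
    then show ?thesis by simp
  qed
  have "\<exists>m. \<forall>x\<in>S. \<forall>y\<in>S. x \<otimes> y \<notin> S \<longrightarrow> x \<otimes> y \<noteq> \<one> \<longrightarrow>
      card {v \<in> S. \<exists>u\<in>S. v \<otimes> u = x \<otimes> y} = m"
  proof (cases "2 \<le> d")
    case True
    obtain m a where m: "\<forall>v\<in>carrier G. gdist \<Gamma> \<one> v = ereal (real 2) \<longrightarrow>
        card (dist_nbhd \<Gamma> (int 2 - 1) \<one> \<inter> dist_nbhd \<Gamma> 1 v) = m \<and>
        card (dist_nbhd \<Gamma> (int 2) \<one> \<inter> dist_nbhd \<Gamma> 1 v) = a"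
      using reg_one[OF True] by blast
    have "card {v \<in> S. \<exists>u\<in>S. v \<otimes> u = x \<otimes> y} = m"
      if "x \<in> S" "y \<in> S" "x \<otimes> y \<notin> S" "x \<otimes> y \<noteq> \<one>" for x y
      using bspec[OF m, of "x \<otimes> y"] dist2[OF that] common[of "x \<otimes> y"] SC that by simp
    then show ?thesis by blast
  next
    case False
    have "\<not> (x \<otimes> y \<notin> S \<and> x \<otimes> y \<noteq> \<one>)" if "x \<in> S" "y \<in> S" for x y
      using le_d[of "x \<otimes> y" 2] dist2[of x y] SC False that by auto
    then show ?thesis by blast
  qed
  then obtain m where m: "\<forall>x\<in>S. \<forall>y\<in>S. x \<otimes> y \<notin> S \<longrightarrow> x \<otimes> y \<noteq> \<one> \<longrightarrow>
      card {v \<in> S. \<exists>u\<in>S. v \<otimes> u = x \<otimes> y} = m" ..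
  show ?thesis by (rule that[OF l m[rule_format]])
qed

text \<open>Because \<open>S S S\<close> lies in \<open>S\<close>, the product set
  \<open>S S\<close> equals the single translate \<open>s S\<close> and so has the size of
  \<open>S\<close>. Products behave like a parity with \<open>P\<close> even and \<open>S\<close>
  odd: \<open>P \<union> S\<close> is a subgroup containing the generators, hence everything, and
  arcs join exactly the elements of different parity.\<close>

lemma (in group) cayley_graph_complete_bipartite:
  assumes fin: "finite S" and S: "S \<subseteq> carrier G" and S_inv: "\<And>s. s \<in> S \<Longrightarrow> inv s \<in> S"
    and ne: "S \<noteq> {}" and gen: "generate G S = carrier G"
    and two: "\<And>x y. x \<in> S \<Longrightarrow> y \<in> S \<Longrightarrow> x \<otimes> y \<notin> S"
    and three: "\<And>x y z. x \<in> S \<Longrightarrow> y \<in> S \<Longrightarrow> z \<in> S \<Longrightarrow> x \<otimes> (y \<otimes> z) \<in> S"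
  shows "digraph_iso (with_proj (cayley_graph G S)) (with_proj (complete_bipartite_graph (card S) (card S)))"
proof -
  have SC [simp]: "x \<in> carrier G" if "x \<in> S" for x using S that by auto
  obtain s where s [simp]: "s \<in> S" using ne by blast
  define P where "P = (\<lambda>y. s \<otimes> y) ` S"
  have PI: "x \<otimes> y \<in> P" if "x \<in> S" "y \<in> S" for x y
  proof -
    have "x \<otimes> y = s \<otimes> (inv s \<otimes> (x \<otimes> y))" using that by (simp flip: m_assoc)
    then show ?thesis using three[of "inv s" x y] S_inv that by (auto simp: P_def)
  qed
  have PE: "\<exists>x\<in>S. \<exists>y\<in>S. g = x \<otimes> y" if "g \<in> P" for g using that s by (auto simp: P_def)
  have PC [simp]: "g \<in> carrier G" if "g \<in> P" for g using PE[OF that] by auto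
  have one: "\<one> \<in> P" using PI[of s "inv s"] S_inv by simp
  have P_inv: "inv g \<in> P" if "g \<in> P" for g
    using PE[OF that] PI S_inv by (auto simp: inv_mult_group)
  have SP: "x \<otimes> g \<in> S" if "x \<in> S" "g \<in> P" for x g
    using PE[OF that(2)] three that by auto
  have PS: "g \<otimes> x \<in> S" if "x \<in> S" "g \<in> P" for x g
    using PE[OF that(2)] three that by (auto simp: m_assoc)
  have PP: "g \<otimes> h \<in> P" if g: "g \<in> P" and h: "h \<in> P" for g h
  proof -
    obtain x y where "x \<in> S" "y \<in> S" "g = x \<otimes> y" using PE[OF g] by blast
    then show ?thesis using PI[of x "y \<otimes> h"] SP[of y h] h by (simp add: m_assoc)
  qed
  have "subgroup (P \<union> S) G"
    by (rule subgroupI) (use one P_inv S_inv PI SP PS PP in auto)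
  then have "carrier G \<subseteq> P \<union> S"
    using generate_subgroup_incl[of S "P \<union> S"] gen by simp
  then have V: "carrier G = P \<union> S" by auto
  have disj: "P \<inter> S = {}" using PE two by blast
  have arcs: "parcs (cayley_graph G S) = P \<times> S \<union> S \<times> P"
  proof -
    have "\<one> \<notin> S" using one disj by auto
    then have S': "S \<subseteq> carrier G - {\<one>}" using S by auto
    have "(g, h) \<in> parcs (cayley_graph G S) \<longleftrightarrow> (g, h) \<in> P \<times> S \<union> S \<times> P" for g h
    proof -
      have "inv h \<otimes> g \<in> S" if "h \<in> S" "g \<in> P" using SP S_inv that by simp
      moreover have "inv h \<otimes> g \<in> S" if "h \<in> P" "g \<in> S" using PS P_inv that by simp
      moreover have "inv h \<otimes> g \<notin> S" if "h \<in> S" "g \<in> S" using two S_inv that by simp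
      moreover have "inv h \<otimes> g \<notin> S" if "h \<in> P" "g \<in> P" using PP P_inv disj that by blast
      ultimately show ?thesis unfolding cayley_graph_arc_iff[OF S'] V using disj by auto
    qed
    then show ?thesis by auto
  qed
  have "inj_on (\<lambda>y. s \<otimes> y) S" by (auto simp: inj_on_def)
  then have "card P = card S" "finite P" using fin by (simp_all add: P_def card_image)
  then show ?thesis
    unfolding digraph_iso_complete_bipartite_iff using fin disj arcs V
    by (intro exI[of _ P] exI[of _ S]) (simp add: cayley_graph_def)
qed

section \<open>Generalized dicyclic groups\<close>

text \<open>The element \<open>t\<close> is replaced by statements about all elements outside
  \<open>A\<close>, which are interchangeable: each squares to \<open>a\<close> and inverts
  \<open>A\<close> by conjugation. Thus any element of a generating set outside \<open>A\<close> can
  take the role of \<open>t\<close>. \<open>A_nontrivial\<close> records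
  \<open>n > 1\<close>.\<close>

locale generalized_dicyclic = group G for G (structure) +
  fixes A :: "'a set" and a :: 'a
  assumes subgroup_A: "subgroup A G"
    and A_comm: "x \<in> A \<Longrightarrow> y \<in> A \<Longrightarrow> x \<otimes> y = y \<otimes> x"
    and A_neq_carrier: "A \<noteq> carrier G"
    and a_in_A [simp]: "a \<in> A"
    and a_neq_one [simp]: "a \<noteq> \<one>"
    and a_square: "a \<otimes> a = \<one>"
    and A_square_one: "x \<in> A \<Longrightarrow> x \<otimes> x = \<one> \<Longrightarrow> x = \<one> \<or> x = a"
    and outside_square: "g \<in> carrier G - A \<Longrightarrow> g \<otimes> g = a"
    and outside_conj: "g \<in> carrier G - A \<Longrightarrow> x \<in> A \<Longrightarrow> g \<otimes> x = inv x \<otimes> g"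
    and A_nontrivial: "\<exists>b\<in>A. b \<notin> {\<one>, a}"
    and finite_carrier: "finite (carrier G)"
begin

lemma A_carrier [simp]: "x \<in> A \<Longrightarrow> x \<in> carrier G"
  using subgroup.subset[OF subgroup_A] by blast

lemma A_closed [simp]:
  "\<one> \<in> A" "x \<in> A \<Longrightarrow> y \<in> A \<Longrightarrow> x \<otimes> y \<in> A" "x \<in> A \<Longrightarrow> inv x \<in> A"
  using subgroup_A by (simp_all add: subgroup.one_closed subgroup.m_closed subgroup.m_inv_closed)

lemma A_lcomm: "x \<in> A \<Longrightarrow> y \<in> A \<Longrightarrow> z \<in> carrier G \<Longrightarrow> x \<otimes> (y \<otimes> z) = y \<otimes> (x \<otimes> z)"
  using A_comm[of x y] by (simp flip: m_assoc)

lemma inv_mult_cancel [simp]: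
  assumes "x \<in> carrier G" "y \<in> carrier G"
  shows "inv x \<otimes> (x \<otimes> y) = y" "x \<otimes> (inv x \<otimes> y) = y"
  using assms by (simp_all flip: m_assoc)

lemma inv_in_A_iff [simp]: "x \<in> carrier G \<Longrightarrow> inv x \<in> A \<longleftrightarrow> x \<in> A"
  using A_closed(3)[of "inv x"] by auto

lemma mult_in_A_iff:
  assumes "x \<in> A" "y \<in> carrier G"
  shows "x \<otimes> y \<in> A \<longleftrightarrow> y \<in> A" "y \<otimes> x \<in> A \<longleftrightarrow> y \<in> A"
proof -
  have "y = inv x \<otimes> (x \<otimes> y)" "y = y \<otimes> x \<otimes> inv x" using assms by (simp_all add: m_assoc)
  then show "x \<otimes> y \<in> A \<longleftrightarrow> y \<in> A" "y \<otimes> x \<in> A \<longleftrightarrow> y \<in> A"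
    using assms A_closed by metis+
qed

lemma inv_a [simp]: "inv a = a"
  using a_square by (simp add: inv_equality)

lemma a_cancel [simp]: "x \<in> carrier G \<Longrightarrow> a \<otimes> (a \<otimes> x) = x"
  using a_square by (simp flip: m_assoc)

lemma a_mult_neq [simp]: "x \<in> carrier G \<Longrightarrow> a \<otimes> x \<noteq> x"
  using r_cancel_one[of x a] by simp

lemma inv_outside:
  assumes "g \<in> carrier G - A"
  shows "inv g = a \<otimes> g"
proof (rule inv_equality)
  show "a \<otimes> g \<otimes> g = \<one>"
    using assms outside_square[OF assms] a_square by (simp add: m_assoc)
qed (use assms in auto)

lemma a_central:
  assumes "g \<in> carrier G"
  shows "g \<otimes> a = a \<otimes> g"
  using assms A_comm[of g a] outside_conj[of g a] by (cases "g \<in> A") auto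

lemma outside_neq_inv: "g \<in> carrier G - A \<Longrightarrow> inv g \<noteq> g"
  using inv_outside by auto

end

section \<open>Counting common neighbours relative to the subgroup \<open>H\<close>\<close>

text \<open>Distance-regularity enters only through the two constants \<open>lam\<close> and
  \<open>mu\<close>, and \<open>H\<close> only as a subgroup that contains
  \<open>S - {s, inv s}\<close> and misses \<open>s\<close>.\<close>

locale generalized_dicyclic_minimal = generalized_dicyclic G A a for G (structure) and A a +
  fixes S H :: "'a set" and s :: 'a and lam mu :: nat and T
  defines "T z \<equiv> {y \<in> S. \<exists>u\<in>S. y \<otimes> u = z}"
  assumes S_sub: "S \<subseteq> carrier G - {\<one>}"
    and S_inv [simp]: "x \<in> S \<Longrightarrow> inv x \<in> S"
    and S_gen: "generate G S = carrier G"
    and s_in_S [simp]: "s \<in> S"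
    and subgroup_H: "subgroup H G"
    and S_diff_sub: "S - {s, inv s} \<subseteq> H"
    and s_notin_H: "s \<notin> H"
    and card_T_adjacent: "x \<in> S \<Longrightarrow> card (T x) = lam"
    and card_T_dist2: "x \<in> S \<Longrightarrow> y \<in> S \<Longrightarrow> x \<otimes> y \<notin> S \<Longrightarrow> x \<otimes> y \<noteq> \<one> \<Longrightarrow> card (T (x \<otimes> y)) = mu"
begin

lemma S_carrier [simp]: "x \<in> S \<Longrightarrow> x \<in> carrier G"
  and one_notin_S [simp]: "\<one> \<notin> S"
  and S_neq_one [simp]: "x \<in> S \<Longrightarrow> x \<noteq> \<one>"
  using S_sub by auto

lemma finite_S [simp]: "finite S"
  using finite_subset[OF _ finite_carrier] S_sub by blast

lemma finite_T [simp]: "finite (T z)"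
  by (simp add: T_def)

lemma inv_in_S_iff [simp]: "x \<in> carrier G \<Longrightarrow> inv x \<in> S \<longleftrightarrow> x \<in> S"
  using S_inv[of "inv x"] by auto

lemma T_I: "y \<in> S \<Longrightarrow> u \<in> S \<Longrightarrow> y \<otimes> u = z \<Longrightarrow> y \<in> T z"
  by (auto simp: T_def)

lemma T_E:
  assumes "y \<in> T z"
  obtains u where "y \<in> S" "u \<in> S" "y \<otimes> u = z"
  using assms by (auto simp: T_def)

lemma H_carrier [simp]: "x \<in> H \<Longrightarrow> x \<in> carrier G"
  using subgroup.subset[OF subgroup_H] by blast

lemma H_closed [simp]:
  "\<one> \<in> H" "x \<in> H \<Longrightarrow> y \<in> H \<Longrightarrow> x \<otimes> y \<in> H" "x \<in> H \<Longrightarrow> inv x \<in> H"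
  using subgroup_H by (simp_all add: subgroup.one_closed subgroup.m_closed subgroup.m_inv_closed)

lemma mult_in_H_iff:
  assumes "x \<in> H" "y \<in> carrier G"
  shows "x \<otimes> y \<in> H \<longleftrightarrow> y \<in> H" "y \<otimes> x \<in> H \<longleftrightarrow> y \<in> H"
proof -
  have "y = inv x \<otimes> (x \<otimes> y)" "y = y \<otimes> x \<otimes> inv x" using assms by (simp_all add: m_assoc)
  then show "x \<otimes> y \<in> H \<longleftrightarrow> y \<in> H" "y \<otimes> x \<in> H \<longleftrightarrow> y \<in> H"
    using assms H_closed by metis+
qed

lemma inv_s_notin_H: "inv s \<notin> H"
  using s_notin_H H_closed(3)[of "inv s"] by auto

lemma S_cases: "y \<in> S \<Longrightarrow> y \<in> H \<or> y = s \<or> y = inv s"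
  using S_diff_sub by auto

lemma generating_not_subset: "S \<subseteq> K \<Longrightarrow> subgroup K G \<Longrightarrow> K = carrier G"
  using generate_subgroup_incl[of S K] S_gen subgroup.subset by blast

lemma S_not_sub_A: "\<exists>w\<in>S. w \<notin> A"
  using generating_not_subset[OF _ subgroup_A] A_neq_carrier by blast

text \<open>An involution must be \<open>a\<close>, since elements outside \<open>A\<close> are
  never their own inverses. But some \<open>w\<close> in \<open>S\<close> lies outside
  \<open>A\<close>; if \<open>s\<close> were its own inverse, \<open>w\<close> would lie in
  \<open>H\<close>, and so would its square \<open>a = s\<close>.\<close>

lemma inv_s_neq_s [simp]: "inv s \<noteq> s" "s \<noteq> inv s"
proof -
  show "inv s \<noteq> s"
  proof
    assume i: "inv s = s"
    then have "s \<in> A" using outside_neq_inv[of s] by auto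
    moreover have "s \<otimes> s = \<one>" using i r_inv[of s] by simp
    ultimately have sa: "s = a" using A_square_one[of s] by auto
    obtain w where w: "w \<in> S" "w \<notin> A" using S_not_sub_A by blast
    then have "w \<in> H" using S_cases[of w] sa i by auto
    moreover have "w \<otimes> w = s" using outside_square[of w] w sa by simp
    ultimately show False using s_notin_H by (metis H_closed(2))
  qed
  then show "s \<noteq> inv s" by metis
qed

text \<open>One of two factors of \<open>s\<close> lies outside \<open>H\<close>, so it is
  \<open>s\<close> or its inverse; a factor \<open>s\<close> would leave \<one> for the other
  one.\<close>

lemma T_s_sub: "T s \<subseteq> {s \<otimes> s, inv s}"
proof
  fix y assume "y \<in> T s"
  then obtain u where u: "y \<in> S" "u \<in> S" "y \<otimes> u = s" by (rule T_E)
  consider "y \<in> H" | "y = s" | "y = inv s" using S_cases[OF u(1)] by blast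
  then show "y \<in> {s \<otimes> s, inv s}"
  proof cases
    case 1
    then have "u \<notin> H" using u s_notin_H by auto
    then consider "u = s" | "u = inv s" using S_cases u by blast
    then show ?thesis
    proof cases
      case 1 then show ?thesis using u by simp
    next
      case 2 then show ?thesis using u inv_solve_right'[of s y s] by simp
    qed
  next
    case 2 then show ?thesis using u by simp
  qed simp
qed

lemma lambda_le_2: "lam \<le> 2"
proof -
  have "card (T s) \<le> card {s \<otimes> s, inv s}" using T_s_sub by (intro card_mono) auto
  also have "\<dots> \<le> 2" by (simp add: card_insert_if)
  finally show ?thesis by (simp add: card_T_adjacent)
qed

text \<open>Both candidates of \<open>T_s_sub\<close> need \<open>s \<otimes> s\<close> in
  \<open>S\<close>: one as the first factor, the other as the second.\<close>

lemma lambda_eq_0: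
  assumes "s \<otimes> s \<notin> S"
  shows "lam = 0"
proof -
  have "T s = {}"
  proof (rule equals0I)
    fix y assume y: "y \<in> T s"
    then obtain u where u: "y \<in> S" "u \<in> S" "y \<otimes> u = s" by (rule T_E)
    then have "y = inv s" using T_s_sub y assms by auto
    then have "u = s \<otimes> s" using u by (metis S_carrier inv_solve_left s_in_S inv_inv inv_closed)
    then show False using u assms by simp
  qed
  then show ?thesis using card_T_adjacent[of s] by simp
qed

text \<open>This puts \<open>s \<otimes> x\<close> at distance 2, so that \<open>mu\<close> counts
  its common neighbours with \<one>. The product is outside \<open>H\<close>, and the only members
  of \<open>S\<close> there are \<open>s\<close> and its inverse; the last assumption excludes the
  inverse.\<close>

lemma coset_product_notin:
  assumes "x \<in> S" "x \<in> H" "x \<noteq> inv s \<otimes> inv s"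
  shows "s \<otimes> x \<notin> S" "s \<otimes> x \<noteq> \<one>"
proof -
  have nH: "s \<otimes> x \<notin> H" using assms mult_in_H_iff[of x s] s_notin_H by simp
  then show "s \<otimes> x \<noteq> \<one>" by (metis H_closed(1))
  have "s \<otimes> x \<noteq> s" using assms by simp
  moreover have "s \<otimes> x \<noteq> inv s" using assms inv_solve_left[of x s "inv s"] by (metis S_carrier S_inv s_in_S inv_solve_left)
  ultimately show "s \<otimes> x \<notin> S" using nH S_cases by blast
qed

text \<open>Since \<open>s \<otimes> x\<close> is outside \<open>H\<close>, one factor is
  \<open>s\<close> or its inverse. The four candidates list these two as first factor and then as
  second factor.\<close>

lemma T_coset_product_sub:
  assumes "x \<in> S" "x \<in> H"
  shows "T (s \<otimes> x) \<subseteq> {s, inv s, s \<otimes> x \<otimes> inv s, s \<otimes> x \<otimes> s}"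
proof
  fix y assume "y \<in> T (s \<otimes> x)"
  then obtain u where u: "y \<in> S" "u \<in> S" "y \<otimes> u = s \<otimes> x" by (rule T_E)
  consider "y \<in> H" | "y = s" | "y = inv s" using S_cases[OF u(1)] by blast
  then show "y \<in> {s, inv s, s \<otimes> x \<otimes> inv s, s \<otimes> x \<otimes> s}"
  proof cases
    case 1
    then have "u \<notin> H" using u s_notin_H assms mult_in_H_iff[of x s] by (metis H_closed(2) S_carrier s_in_S)
    then consider "u = s" | "u = inv s" using S_cases u by blast
    then show ?thesis
    proof cases
      case 1
      have "y = s \<otimes> x \<otimes> inv s" using u assms unfolding 1 by (simp flip: u(3)[unfolded 1] add: m_assoc)
      then show ?thesis by simp
    next
      case 2
      have "y = s \<otimes> x \<otimes> s" using u assms unfolding 2 by (simp flip: u(3)[unfolded 2] add: m_assoc)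
      then show ?thesis by simp
    qed
  qed auto
qed

text \<open>If \<open>mu = 4\<close>, all four candidates must occur. In particular
  \<open>inv s\<close> does, and its second factor is
  \<open>s \<otimes> s \<otimes> x\<close>.\<close>

lemma
  assumes "x \<in> S" "x \<in> H" "x \<noteq> inv s \<otimes> inv s"
  shows mu_le_4: "mu \<le> 4" and mu_eq_4D: "mu = 4 \<Longrightarrow> s \<otimes> s \<otimes> x \<in> S"
proof -
  let ?F = "{s, inv s, s \<otimes> x \<otimes> inv s, s \<otimes> x \<otimes> s}"
  have F: "card ?F \<le> 4" by (simp add: card_insert_if)
  have c: "card (T (s \<otimes> x)) = mu"
    using card_T_dist2[of s x] coset_product_notin[OF assms] assms by simp
  then show "mu \<le> 4"
    using card_mono[OF _ T_coset_product_sub[OF assms(1,2)]] F by simp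
  assume "mu = 4"
  then have "T (s \<otimes> x) = ?F"
    using card_seteq[OF _ T_coset_product_sub[OF assms(1,2)]] F c by simp
  then have "inv s \<in> T (s \<otimes> x)" by simp
  then obtain u where u: "u \<in> S" "inv s \<otimes> u = s \<otimes> x" by (rule T_E)
  have "u = s \<otimes> s \<otimes> x" using u assms by (metis S_carrier inv_mult_cancel(2) m_assoc s_in_S)
  then show "s \<otimes> s \<otimes> x \<in> S" using u by simp
qed

section \<open>Determination of the degree and of \<open>lam\<close> and \<open>mu\<close>\<close>

text \<open>
  Inside \<open>A\<close> the common neighbours of \<open>\<one>\<close> and \<open>x\<^sup>2\<close> come in pairs \<open>y, x\<^sup>2 y\<^sup>-\<^sup>1\<close>; if besides \<open>x\<close>
  there is only one of them, it satisfies \<open>y\<^sup>2 = x\<^sup>2\<close>.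
\<close>

lemma a_mult_in_S:
  assumes x: "x \<in> S" "x \<in> A" and c: "card (T (x \<otimes> x)) = 2"
    and out: "\<And>y u. y \<in> S - A \<Longrightarrow> u \<in> S - A \<Longrightarrow> y \<otimes> u \<noteq> x \<otimes> x"
  shows "a \<otimes> x \<in> S"
proof -
  have xT: "x \<in> T (x \<otimes> x)" using x by (intro T_I) auto
  have "\<exists>y\<in>T (x \<otimes> x). y \<noteq> x"
  proof (rule ccontr)
    assume "\<not> ?thesis"
    then have "T (x \<otimes> x) \<subseteq> {x}" by blast
    then show False using c card_mono[of "{x}" "T (x \<otimes> x)"] by simp
  qed
  then obtain y where y: "y \<in> T (x \<otimes> x)" "y \<noteq> x" by blast
  then obtain u where u: "y \<in> S" "u \<in> S" "y \<otimes> u = x \<otimes> x" by (meson T_E)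
  have yA: "y \<in> A"
  proof (rule ccontr)
    assume "y \<notin> A"
    moreover have "u \<notin> A" using u \<open>y \<notin> A\<close> x mult_in_A_iff(2)[of u y] by auto
    ultimately show False using out u by auto
  qed
  then have uA: "u \<in> A" using u x mult_in_A_iff(1)[of y u] by auto
  have "u \<otimes> y = x \<otimes> x" using A_comm[OF uA yA] u by simp
  then have uT: "u \<in> T (x \<otimes> x)" using u by (intro T_I) auto
  have "u \<noteq> x" using u(1,3) y(2) x r_cancel[of x y x] by auto
  have "u = y"
  proof (rule ccontr)
    assume "u \<noteq> y"
    then have "card {x, y, u} = 3" using \<open>u \<noteq> x\<close> y by auto
    moreover have "card {x, y, u} \<le> card (T (x \<otimes> x))" using xT uT y by (intro card_mono) auto
    ultimately show False using c by simp
  qed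
  then have yy: "y \<otimes> y = x \<otimes> x" using u by simp
  \<comment> \<open>The quotient of two square roots of one element of \<open>A\<close> squares to
    \<one>, so it is \<one> or \<open>a\<close>; the first is excluded by
    \<open>y \<noteq> x\<close>.\<close>
  have "(y \<otimes> inv x) \<otimes> (y \<otimes> inv x) = (y \<otimes> y) \<otimes> (inv x \<otimes> inv x)"
    using x yA by (simp add: m_assoc A_comm A_lcomm)
  also have "\<dots> = \<one>" using x yA unfolding yy by (simp add: m_assoc)
  finally have "y \<otimes> inv x = \<one> \<or> y \<otimes> inv x = a" using x yA by (intro A_square_one) auto
  moreover have "y = (y \<otimes> inv x) \<otimes> x" using x yA by (simp add: m_assoc)
  ultimately have "y = a \<otimes> x" using y x by auto
  then show ?thesis using u by simp
qed

text \<open>Elements of \<open>S\<close> outside \<open>A\<close> now lie in \<open>H\<close>; fix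
  one, \<open>w\<close>. Counting \<open>T (s \<otimes> w)\<close> leaves \<open>mu\<close> 2 or 4.
  The value 2 is refuted according to whether \<open>a\<close> is in \<open>S\<close>, and for 4 the
  set \<open>T (s \<otimes> s)\<close> is too small for any element beyond \<open>s\<close>,
  \<open>w\<close> and their inverses.\<close>

lemma parameters_if_s_in_A:
  assumes sA: "s \<in> A"
  shows "card S = 4 \<and> lam = 0 \<and> mu = 4"
proof -
  obtain w where w [simp]: "w \<in> S" "w \<notin> A" using S_not_sub_A by blast
  have HA: "x \<in> H" if "x \<in> S" "x \<notin> A" for x
    using S_cases[OF that(1)] that sA by auto
  have wH [simp]: "w \<in> H" using HA by simp
  have sq: "x \<otimes> x = a" if "x \<in> S" "x \<notin> A" for x
    using outside_square[of x] that by simp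
  have aH: "a \<in> H" using H_closed(2)[OF wH wH] sq by simp
  have iw: "inv w = a \<otimes> w" and iw_neq: "inv w \<noteq> w"
    using inv_outside[of w] outside_neq_inv[of w] by auto
  have conj: "x \<otimes> s = inv s \<otimes> x" "x \<otimes> inv s = s \<otimes> x" if "x \<in> S" "x \<notin> A" for x
    using that sA outside_conj[of x s] outside_conj[of x "inv s"] by auto
  have w_neq: "x \<noteq> inv s \<otimes> inv s" if "x \<notin> A" for x
    using sA that by auto
  have sw: "s \<otimes> w \<notin> S" "s \<otimes> w \<noteq> \<one>" using coset_product_notin[OF w(1) wH w_neq[OF w(2)]] by auto
  have sH: "x \<noteq> s" "x \<noteq> inv s" if "x \<in> H" for x
    using that s_notin_H inv_s_notin_H by auto
  have ss1: "s \<otimes> s \<noteq> \<one>"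
  proof
    assume "s \<otimes> s = \<one>"
    then have "inv s = s" by (intro inv_equality) auto
    then show False by simp
  qed
  have mu_cases: "mu = 2 \<or> mu = 4"
  proof -
    \<comment> \<open>The candidates of \<open>T_coset_product_sub\<close>, simplified by
      \<open>w\<close> inverting \<open>s\<close>. Here \<open>s\<close> and \<open>w\<close> always
      occur, while the other two occur exactly when \<open>s \<otimes> s \<otimes> w\<close> is in
      \<open>S\<close>.\<close>
    let ?F = "{s, inv s, s \<otimes> s \<otimes> w, w}"
    have "s \<otimes> w \<otimes> inv s = s \<otimes> s \<otimes> w" "s \<otimes> w \<otimes> s = w"
      using conj[OF w] by (simp_all add: m_assoc)
    then have sub: "T (s \<otimes> w) \<subseteq> ?F" using T_coset_product_sub[OF w(1) wH] by simp
    have T1: "s \<in> T (s \<otimes> w)" by (intro T_I[of _ w]) auto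
    have T2: "w \<in> T (s \<otimes> w)" using conj[OF w] by (intro T_I[of _ "inv s"]) auto
    have mu: "card (T (s \<otimes> w)) = mu" using card_T_dist2[of s w] sw by simp
    have neq: "s \<noteq> w" "inv s \<noteq> w" "s \<otimes> s \<otimes> w \<noteq> w" "s \<otimes> s \<otimes> w \<noteq> s" "s \<otimes> s \<otimes> w \<noteq> inv s"
      using sA ss1 w(2) r_cancel_one[of w "s \<otimes> s"] mult_in_A_iff(1)[of "s \<otimes> s" w] by auto
    show ?thesis
    proof (cases "s \<otimes> s \<otimes> w \<in> S")
      case True
      have "s \<otimes> s \<otimes> w \<in> T (s \<otimes> w)"
        using True conj[OF w] by (intro T_I[of _ s]) (auto simp: m_assoc)
      moreover have "inv s \<in> T (s \<otimes> w)"
        using True by (intro T_I[of _ "s \<otimes> s \<otimes> w"]) (auto simp: m_assoc)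
      ultimately have "T (s \<otimes> w) = ?F" using T1 T2 sub by blast
      then show ?thesis using mu neq by (auto simp: card_insert_if)
    next
      case False
      then have "s \<otimes> s \<otimes> w \<notin> T (s \<otimes> w)" by (auto simp: T_def)
      moreover have "inv s \<notin> T (s \<otimes> w)"
      proof
        assume "inv s \<in> T (s \<otimes> w)"
        then obtain u where "u \<in> S" "inv s \<otimes> u = s \<otimes> w" by (rule T_E)
        then have "u = s \<otimes> s \<otimes> w" by (metis S_carrier inv_mult_cancel(2) m_assoc s_in_S w(1))
        then show False using False \<open>u \<in> S\<close> by simp
      qed
      ultimately have "T (s \<otimes> w) = {s, w}" using T1 T2 sub by blast
      then show ?thesis using mu neq by auto
    qed
  qed
  have W_T: "x \<in> T a" if "x \<in> S" "x \<notin> A" for x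
    using that sq by (intro T_I[of _ x]) auto
  \<comment> \<open>All of \<open>S - A\<close> lies in \<open>T a\<close>, so a \<open>T a\<close>
    with at most two elements leaves only \<open>w\<close> and its inverse.\<close>
  have W_eq: "y = w \<or> y = inv w" if c: "card (T a) \<le> 2" and y: "y \<in> S" "y \<notin> A" for y
  proof (rule ccontr)
    assume "\<not> ?thesis"
    then have "card {y, w, inv w} = 3" using iw_neq by auto
    moreover have "card {y, w, inv w} \<le> card (T a)"
      using W_T y by (intro card_mono) auto
    ultimately show False using c by simp
  qed
  have "False" if mu: "mu = 2"
  proof (cases "a \<in> S")
    case False
    have "card (T a) = 2" using card_T_dist2[OF w(1) w(1)] sq[OF w] False mu by simp
    note W = W_eq[OF eq_imp_le[OF this]]
    \<comment> \<open>A factor of \<open>w\<close> outside \<open>A\<close> is \<open>w\<close> or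
      its inverse. The former makes the other factor \<one>, the latter makes it \<open>a\<close>;
      neither is in \<open>S\<close>.\<close>
    have "T w = {}"
    proof (rule equals0I)
      fix y assume "y \<in> T w"
      then obtain u where u: "y \<in> S" "u \<in> S" "y \<otimes> u = w" by (rule T_E)
      show False
      proof (cases "y \<in> A")
        case True
        then have "u \<notin> A" using u(3) w(2) A_closed(2) by metis
        then consider "u = w" | "u = inv w" using W u by blast
        then show False
        proof cases
          case 1
          then show False using u by (simp add: l_cancel_one)
        next
          case 2
          then have "y = w \<otimes> w" using u inv_solve_right'[of w y w] by simp
          then show False using u sq False by simp
        qed
      next
        case nA: False
        then consider "y = w" | "y = inv w" using W u by blast
        then show False
        proof cases
          case 1
          then show False using u by simp
        next
          case 2
          then have "u = w \<otimes> w" using u by (metis S_carrier inv_mult_cancel(2) w(1))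
          then show False using u sq False by simp
        qed
      qed
    qed
    then have "lam = 0" using card_T_adjacent[of w] by simp
    then have ss: "s \<otimes> s \<notin> S" using card_T_adjacent[of "s \<otimes> s"] T_I[of s s "s \<otimes> s"] by fastforce
    have ss_T: "card (T (s \<otimes> s)) = 2" using card_T_dist2[of s s] ss ss1 mu by simp
    have ssa: "s \<otimes> s \<noteq> a"
    proof
      assume e: "s \<otimes> s = a"
      have "card {s, w, inv w} \<le> card (T (s \<otimes> s))"
        using W_T[of w] W_T[of "inv w"] T_I[of s s "s \<otimes> s"] e by (intro card_mono) auto
      then show False using ss_T iw_neq sH(1)[OF wH] sH(1)[of "inv w"] by auto
    qed
    have "a \<otimes> s \<in> S"
    proof (rule a_mult_in_S[OF _ sA ss_T])
      fix y u assume "y \<in> S - A" "u \<in> S - A"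
      then have "y \<in> {w, inv w}" "u \<in> {w, inv w}" using W by auto
      moreover have "inv w \<otimes> inv w = a" using sq[of "inv w"] by simp
      ultimately show "y \<otimes> u \<noteq> s \<otimes> s" using ssa ss1 sq[OF w] by auto
    qed simp
    \<comment> \<open>As \<open>a\<close> is a square of \<open>w\<close>, it lies in
      \<open>H\<close>; so \<open>a \<otimes> s\<close> stays outside \<open>H\<close> and can only
      be \<open>inv s\<close>, which forces the excluded equation
      \<open>s \<otimes> s = a\<close>.\<close>
    moreover have "a \<otimes> s \<notin> H" using mult_in_H_iff(1)[OF aH, of s] s_notin_H by simp
    ultimately have "a \<otimes> s = inv s" using S_cases[of "a \<otimes> s"] by auto
    then have "s \<otimes> (a \<otimes> s) = \<one>" by simp
    then have "a \<otimes> (s \<otimes> s) = \<one>" using sA by (simp add: A_lcomm)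
    then have "s \<otimes> s = a" using a_cancel[of "s \<otimes> s"] by simp
    then show False using ssa by simp
  next
    case True
    have cTa: "card (T a) = lam" using card_T_adjacent[OF True] .
    then have le: "card (T a) \<le> 2" using lambda_le_2 by simp
    note W = W_eq[OF le]
    have sub: "{w, inv w} \<subseteq> T a" using W_T by auto
    have "T a = {w, inv w}"
      using card_seteq[OF _ sub] le iw_neq by auto
    then have lam: "lam = 2" using cTa iw_neq by auto
    have no_a: "a \<otimes> y \<notin> S" if y: "y \<in> S" "y \<in> A" for y
    proof
      assume "a \<otimes> y \<in> S"
      then have "inv (a \<otimes> y) \<in> S" by simp
      then have "y \<in> T a" using y by (intro T_I[of _ "inv (a \<otimes> y)"]) (auto simp: inv_mult_group)
      then show False using \<open>T a = _\<close> y by auto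
    qed
    \<comment> \<open>The contradiction will be a set \<open>T x\<close> with three elements, from
      the factorisations of \<open>x\<close> as \<open>s s\<close>, \<open>x^2 x^-1\<close> and
      \<open>x^-1 x^2\<close>, against \<open>lam = 2\<close>.\<close>
    define x where "x = s \<otimes> s"
    have xA [simp]: "x \<in> A" using sA by (simp add: x_def)
    have xS [simp]: "x \<in> S"
      using lambda_eq_0 lam by (auto simp: x_def)
    have x_neq: "x \<noteq> inv s"
    proof
      assume "x = inv s"
      then have "T s \<subseteq> {inv s}" using T_s_sub by (auto simp: x_def)
      then have "card (T s) \<le> 1" using card_mono[of "{inv s}" "T s"] by simp
      then show False using card_T_adjacent[of s] lam by simp
    qed
    have x_neq_s: "x \<noteq> s" by (simp add: x_def)
    have xH: "x \<in> H" using S_cases[OF xS] x_neq x_neq_s by auto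
    have "x \<noteq> a"
    proof
      assume "x = a"
      then have "s \<in> T a" by (intro T_I[of _ s]) (auto simp: x_def)
      then show False using \<open>T a = _\<close> sA by auto
    qed
    then have xx1: "x \<otimes> x \<noteq> \<one>" using A_square_one[of x] by auto
    have xxS: "x \<otimes> x \<in> S"
    proof (rule ccontr)
      assume nS: "x \<otimes> x \<notin> S"
      have "a \<otimes> x \<in> S"
      proof (rule a_mult_in_S)
        show "card (T (x \<otimes> x)) = 2" using card_T_dist2[of x x] nS xx1 mu by simp
        fix y u assume "y \<in> S - A" "u \<in> S - A"
        then have "y \<in> {w, inv w}" "u \<in> {w, inv w}" using W by auto
        moreover have "inv w \<otimes> inv w = a" using sq[of "inv w"] by simp
        ultimately show "y \<otimes> u \<noteq> x \<otimes> x" using nS True xx1 sq[OF w] by auto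
      qed simp_all
      then show False using no_a by simp
    qed
    \<comment> \<open>Otherwise \<open>x^3 = s^6\<close> is \<one>, so
      \<open>s \<otimes> x = s^3\<close> is a square root of \<one> in \<open>A\<close>. Then it is
      \<one> or \<open>a\<close>, hence in \<open>H\<close>, although \<open>x\<close> is in
      \<open>H\<close> and \<open>s\<close> is not.\<close>
    have xx_neq: "x \<otimes> x \<noteq> inv x"
    proof
      assume e: "x \<otimes> x = inv x"
      have sx: "s \<otimes> x \<in> A" using sA by simp
      have "(s \<otimes> x) \<otimes> (s \<otimes> x) = x \<otimes> (x \<otimes> x)"
        unfolding x_def using sA by (simp add: m_assoc)
      then have "(s \<otimes> x) \<otimes> (s \<otimes> x) = \<one>" by (simp add: e)
      then have "s \<otimes> x = \<one> \<or> s \<otimes> x = a" using A_square_one[OF sx] by simp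
      then have "s \<otimes> x \<in> H" using aH by auto
      then show False using mult_in_H_iff(2)[OF xH, of s] s_notin_H by simp
    qed
    have "{s, x \<otimes> x, inv x} \<subseteq> T x"
      using xxS by (auto simp: m_assoc intro: T_I[of s s] T_I[of "inv x" "x \<otimes> x"] T_I[of "x \<otimes> x" "inv x"] simp flip: x_def)
    then have "card {s, x \<otimes> x, inv x} \<le> 2"
      using card_mono[of "T x"] card_T_adjacent[OF xS] lam by fastforce
    moreover have "card {s, x \<otimes> x, inv x} = 3"
      using xx_neq sH(1)[of "x \<otimes> x"] sH(1)[of "inv x"] xH by auto
    ultimately show False by simp
  qed
  then have mu: "mu = 4" using mu_cases by blast
  have ssx: "s \<otimes> s \<otimes> x \<in> S" if "x \<in> S" "x \<in> H" "x \<noteq> inv s \<otimes> inv s" for x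
    using mu_eq_4D[OF that mu] .
  have ssx_T: "s \<otimes> s \<otimes> x \<in> T (s \<otimes> s)" if "x \<in> S" "x \<in> H" "x \<noteq> inv s \<otimes> inv s" for x
    using ssx[OF that] that by (intro T_I[of _ "inv x"]) (auto simp: m_assoc)
  have ssw_T: "s \<otimes> s \<otimes> w \<in> T (s \<otimes> s)" "s \<otimes> s \<otimes> inv w \<in> T (s \<otimes> s)"
    using ssx_T[of w] ssx_T[of "inv w"] w_neq by auto
  \<comment> \<open>With \<open>mu = 4\<close>, the element \<open>s \<otimes> s \<otimes> w\<close>
    is in \<open>S\<close> and outside \<open>A\<close>, hence in \<open>H\<close>; cancelling
    \<open>w\<close> puts \<open>s \<otimes> s\<close> into \<open>H\<close>.\<close>
  have "s \<otimes> s = (s \<otimes> s \<otimes> w) \<otimes> inv w" by (simp add: m_assoc)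
  moreover have "s \<otimes> s \<otimes> w \<in> H" using HA[OF ssx[of w]] w_neq sA mult_in_A_iff(1)[of "s \<otimes> s" w] by simp
  ultimately have ssH: "s \<otimes> s \<in> H" by (metis H_closed(2,3) wH)
  have s_T: "s \<in> T (s \<otimes> s)" by (intro T_I) auto
  have ss_cancel: "s \<otimes> s \<otimes> x = s \<otimes> s \<otimes> y \<longleftrightarrow> x = y" if "x \<in> carrier G" "y \<in> carrier G" for x y
    using that by simp
  have s_neq: "s \<noteq> s \<otimes> s \<otimes> x" if "x \<in> H" for x
    using sH(1)[OF H_closed(2)[OF ssH that]] by metis
  have ssS: "s \<otimes> s \<notin> S"
  proof
    assume S: "s \<otimes> s \<in> S"
    have "card {s, s \<otimes> s \<otimes> w, s \<otimes> s \<otimes> inv w} = 3"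
      using s_neq[of w] s_neq[of "inv w"] ss_cancel[of w "inv w"] iw_neq by auto
    moreover have "card {s, s \<otimes> s \<otimes> w, s \<otimes> s \<otimes> inv w} \<le> card (T (s \<otimes> s))"
      using s_T ssw_T by (intro card_mono) auto
    ultimately show False using card_T_adjacent[OF S] lambda_le_2 by simp
  qed
  then have lam: "lam = 0" by (rule lambda_eq_0)
  have cT: "card (T (s \<otimes> s)) = 4" using card_T_dist2[of s s] ssS ss1 mu by simp
  \<comment> \<open>Left multiplication by \<open>s \<otimes> s\<close> carries four elements of
    \<open>S \<inter> H\<close> into \<open>T (s \<otimes> s)\<close>, inside \<open>H\<close>;
    together with \<open>s\<close> that makes five, one too many.\<close>
  have five: False if "x \<in> S" "y \<in> S" "x \<in> H" "y \<in> H" "distinct [w, inv w, x, y]" for x y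
  proof -
    have n: "z \<noteq> inv s \<otimes> inv s" if "z \<in> S" for z
    proof
      assume "z = inv s \<otimes> inv s"
      then have "inv z = s \<otimes> s" by (simp add: inv_mult_group)
      then show False using S_inv[OF that] ssS by simp
    qed
    let ?D = "(\<lambda>z. s \<otimes> s \<otimes> z) ` {w, inv w, x, y}"
    have "inj_on (\<lambda>z. s \<otimes> s \<otimes> z) {w, inv w, x, y}"
      using that ss_cancel by (auto simp: inj_on_def)
    then have "card ?D = 4" using that(5) card_image by fastforce
    moreover have "s \<notin> ?D" using s_neq that by auto
    ultimately have "card (insert s ?D) = 5" by simp
    moreover have "insert s ?D \<subseteq> T (s \<otimes> s)" using s_T ssw_T ssx_T that n by auto
    ultimately show False using card_mono[of "T (s \<otimes> s)" "insert s ?D"] cT by simp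
  qed
  have "S \<subseteq> {s, inv s, w, inv w}"
  proof
    fix x assume x: "x \<in> S"
    show "x \<in> {s, inv s, w, inv w}"
    proof (rule ccontr)
      assume nx: "x \<notin> {s, inv s, w, inv w}"
      then have xH: "x \<in> H" using S_cases[OF x] by auto
      show False
      \<comment> \<open>One extra element yields a second one for \<open>five\<close>:
        \<open>s \<otimes> s \<otimes> x\<close> if \<open>x\<close> is in \<open>A\<close>, and
        \<open>inv x\<close> otherwise.\<close>
      proof (cases "x \<in> A")
        case True
        have nss: "x \<noteq> inv s \<otimes> inv s"
        proof
          assume "x = inv s \<otimes> inv s"
          then have "inv x = s \<otimes> s" by (simp add: inv_mult_group)
          then show False using S_inv[OF x] ssS by simp
        qed
        have "s \<otimes> s \<otimes> x \<noteq> x" using ss1 x r_cancel_one[of x "s \<otimes> s"] by simp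
        moreover have "s \<otimes> s \<otimes> x \<in> A" using True sA by simp
        moreover have "z \<noteq> w" "z \<noteq> inv w" if "z \<in> A" for z
          using that w(2) inv_in_A_iff[of w] by auto
        ultimately have "distinct [w, inv w, x, s \<otimes> s \<otimes> x]"
          using True iw_neq by (metis distinct_length_2_or_more distinct_singleton)
        then show False
          using five[OF x ssx[OF x xH nss] xH H_closed(2)[OF ssH xH]] by blast
      next
        case False
        then have "inv x \<noteq> x" using outside_neq_inv[of x] x by auto
        moreover have "inv x \<noteq> w" "inv x \<noteq> inv w" using nx x by auto
        ultimately show False
          using five[OF x S_inv[OF x] xH H_closed(3)[OF xH]] nx iw_neq by auto
      qed
    qed
  qed
  then have "S = {s, inv s, w, inv w}" by auto
  moreover have "card {s, inv s, w, inv w} = 4"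
    using sH[of w] sH[of "inv w"] iw_neq by auto
  ultimately have "card S = 4" by simp
  then show ?thesis using lam mu by simp
qed

text \<open>Now \<open>s \<otimes> s = a\<close>, and \<open>T a\<close> contains \<open>s\<close>
  and its inverse. If some further obvious element lies in \<open>T a\<close>, the count yields
  \<open>T a = S\<close> and \<open>mu = 4\<close>; if none does, \<open>S\<close> meets
  \<open>A\<close> in elements whose powers produce a contradiction.\<close>

lemma parameters_if_s_notin_A:
  assumes sA: "s \<notin> A"
  shows "card S = 4 \<and> lam = 0 \<and> mu = 4"
proof -
  have ss: "s \<otimes> s = a" using outside_square[of s] sA by simp
  have inv_s: "inv s = a \<otimes> s" using inv_outside[of s] sA by simp
  have sA_neq: "s \<noteq> z" "inv s \<noteq> z" if "z \<in> A" for z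
    using that sA inv_in_A_iff[of s] by auto
  have isis: "inv s \<otimes> inv s = a" using outside_square[of "inv s"] sA by simp
  have xH: "x \<in> H" if "x \<in> S" "x \<in> A" for x
    using S_cases[OF that(1)] that sA by auto
  have s_conj: "s \<otimes> x = inv x \<otimes> s" "x \<otimes> s = s \<otimes> inv x" if "x \<in> A" for x
    using that sA outside_conj[of s x] outside_conj[of s "inv x"] by auto
  have a_inv: "a \<otimes> inv x \<in> S \<longleftrightarrow> a \<otimes> x \<in> S" if "x \<in> carrier G" for x
  proof -
    have "inv (a \<otimes> x) = a \<otimes> inv x" using that a_central[of "inv x"] by (simp add: inv_mult_group)
    then show ?thesis using that by (metis inv_in_S_iff A_carrier a_in_A m_closed)
  qed
  have mu_cases: "mu = (if a \<otimes> x \<in> S then 4 else 2)" if x: "x \<in> S" "x \<in> A" "x \<noteq> a" for x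
  proof -
    \<comment> \<open>The candidates for \<open>T (s \<otimes> x)\<close>, rewritten with
      \<open>s\<close> inverting \<open>x\<close>. The elements \<open>s\<close> and
      \<open>inv x\<close> always occur; the other two need \<open>a \<otimes> x\<close> in
      \<open>S\<close>.\<close>
    let ?F = "{s, inv s, inv x, a \<otimes> inv x}"
    have x': "x \<noteq> inv s \<otimes> inv s" using x isis by simp
    have xs: "s \<otimes> x \<otimes> inv s = inv x" using s_conj(1)[OF x(2)] x by (simp add: m_assoc)
    have "s \<otimes> x \<otimes> s = a \<otimes> inv x"
      using s_conj(1)[OF x(2)] x a_central[of "inv x"] by (simp add: m_assoc ss)
    then have sub: "T (s \<otimes> x) \<subseteq> ?F" using T_coset_product_sub[OF x(1) xH[OF x(1,2)]] xs by simp
    have T1: "s \<in> T (s \<otimes> x)" using x by (intro T_I[of _ x]) auto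
    have T2: "inv x \<in> T (s \<otimes> x)" using s_conj(1)[OF x(2)] x by (intro T_I[of _ s]) auto
    have mu: "card (T (s \<otimes> x)) = mu"
      using card_T_dist2[of s x] coset_product_notin[OF x(1) xH[OF x(1,2)] x'] x by simp
    have neq: "s \<noteq> inv x" "inv s \<noteq> inv x" "a \<otimes> inv x \<noteq> inv x" "s \<noteq> a \<otimes> inv x" "inv s \<noteq> a \<otimes> inv x"
      using sA_neq[of "inv x"] sA_neq[of "a \<otimes> inv x"] x by auto
    show ?thesis
    proof (cases "a \<otimes> x \<in> S")
      case True
      have "inv s \<otimes> a = s" using a_central[of "inv s"] by (simp add: inv_s)
      then have "inv s \<otimes> (a \<otimes> x) = s \<otimes> x" using x by (simp flip: m_assoc)
      then have "inv s \<in> T (s \<otimes> x)" by (rule T_I[OF S_inv[OF s_in_S] True])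
      moreover have "a \<otimes> inv x \<in> T (s \<otimes> x)"
      proof (rule T_I[of _ "inv s"])
        have "a \<otimes> inv x \<otimes> inv s = inv x \<otimes> s"
          using x a_central[of "inv x"] by (simp add: inv_s m_assoc) (simp flip: m_assoc add: a_square)
        then show "a \<otimes> inv x \<otimes> inv s = s \<otimes> x" using s_conj(1)[OF x(2)] by simp
      qed (use True a_inv x in auto)
      ultimately have "T (s \<otimes> x) = ?F" using T1 T2 sub by blast
      then show ?thesis using mu neq True by (auto simp: card_insert_if)
    next
      case False
      then have "a \<otimes> inv x \<notin> T (s \<otimes> x)" using a_inv[of x] x by (auto simp: T_def)
      moreover have "inv s \<notin> T (s \<otimes> x)"
      proof
        assume "inv s \<in> T (s \<otimes> x)"
        then obtain u where "u \<in> S" "inv s \<otimes> u = s \<otimes> x" by (rule T_E)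
        then have "u = s \<otimes> s \<otimes> x" by (metis S_carrier inv_mult_cancel(2) m_assoc s_in_S x(1))
        then show False using False \<open>u \<in> S\<close> ss by simp
      qed
      ultimately have "T (s \<otimes> x) = {s, inv x}" using T1 T2 sub by blast
      then show ?thesis using mu neq False by auto
    qed
  qed
  have out_T: "y \<in> T a" if "y \<in> S" "y \<notin> A" for y
    using that outside_square[of y] by (intro T_I[of _ y]) auto
  have x_T: "x \<in> T a" if "x \<in> S" "x \<in> A" "a \<otimes> x \<in> S" for x
    using that a_inv[of x] A_lcomm[of x a "inv x"] by (intro T_I[of _ "a \<otimes> inv x"]) auto
  show ?thesis
  proof (cases "(\<exists>w\<in>S. w \<notin> A \<and> w \<noteq> s \<and> w \<noteq> inv s) \<or> (\<exists>x\<in>S. x \<in> A \<and> a \<otimes> x \<in> S)")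
    case True
    \<comment> \<open>The case assumption gives \<open>T a\<close> a third element besides
      \<open>s\<close> and \<open>inv s\<close>, too many for a neighbour of \<one> because
      \<open>lam \<le> 2\<close>.\<close>
    have aS: "a \<notin> S"
    proof
      assume "a \<in> S"
      then have c: "card (T a) \<le> 2" using card_T_adjacent lambda_le_2 by simp
      obtain z where "z \<in> T a" "z \<noteq> s" "z \<noteq> inv s"
        using True out_T x_T sA by (metis inv_in_A_iff S_carrier s_in_S)
      then have "card {s, inv s, z} = 3" "{s, inv s, z} \<subseteq> T a"
        using out_T[of s] out_T[of "inv s"] sA by auto
      then show False using c card_mono[of "T a" "{s, inv s, z}"] by simp
    qed
    have lam: "lam = 0" using lambda_eq_0 aS ss by simp
    have c: "card (T a) = mu" using card_T_dist2[of s s] ss aS by simp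
    have "T a = S \<and> mu = 4"
    proof (cases "\<exists>x\<in>S. x \<in> A \<and> a \<otimes> x \<in> S")
      case True
      then obtain x where x: "x \<in> S" "x \<in> A" "a \<otimes> x \<in> S" by blast
      then have "x \<noteq> a" using a_square by auto
      then have mu: "mu = 4" using mu_cases[of x] x by simp
      \<comment> \<open>\<open>mu_cases\<close> is read backwards: \<open>mu = 4\<close> forces
        \<open>a \<otimes> y\<close> into \<open>S\<close> for every such \<open>y\<close>.\<close>
      have "a \<otimes> y \<in> S" if "y \<in> S" "y \<in> A" for y
        using mu_cases[of y] mu that aS by (cases "y = a") (auto split: if_splits)
      then have "S \<subseteq> T a" using out_T x_T by blast
      then show ?thesis using mu by (auto simp: T_def)
    next
      case no: False
      then obtain w where w: "w \<in> S" "w \<notin> A" "w \<noteq> s" "w \<noteq> inv s" using True by blast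
      then have wH: "w \<in> H" using S_cases by blast
      have "w \<noteq> inv s \<otimes> inv s" using w(2) a_in_A unfolding isis by metis
      then have le: "mu \<le> 4" using mu_le_4[OF w(1) wH] by simp
      have "inv w \<noteq> w" "inv w \<noteq> s" "inv w \<noteq> inv s"
        using w outside_neq_inv[of w] inv_inv[of w] by (auto simp del: inv_inv)
      then have "card {s, inv s, w, inv w} = 4" using w by auto
      moreover have "{s, inv s, w, inv w} \<subseteq> T a" using out_T w sA by auto
      ultimately have mu: "mu = 4"
        using le c card_mono[of "T a" "{s, inv s, w, inv w}"] by simp
      have "y \<notin> A" if "y \<in> S" for y
      proof
        assume "y \<in> A"
        moreover have "y \<noteq> a" using aS that by auto
        ultimately show False using mu_cases[of y] mu no that by auto
      qed
      then have "S \<subseteq> T a" using out_T by blast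
      then show ?thesis using mu by (auto simp: T_def)
    qed
    then show ?thesis using lam c by simp
  next
    case False
    then have W: "y = s \<or> y = inv s" if "y \<in> S" "y \<notin> A" for y using that by blast
    have no_a: "a \<otimes> x \<notin> S" if "x \<in> S" "x \<in> A" for x using False that by blast
    have out: "y \<otimes> u \<in> {\<one>, a}" if "y \<in> S - A" "u \<in> S - A" for y u
      using W[of y] W[of u] that ss isis by auto
    have Ta: "T a = {s, inv s}"
    proof
      show "T a \<subseteq> {s, inv s}"
      proof
        fix y assume "y \<in> T a"
        then obtain u where u: "y \<in> S" "u \<in> S" "y \<otimes> u = a" by (rule T_E)
        show "y \<in> {s, inv s}"
        proof (cases "y \<in> A")
          case True
          have "u = inv y \<otimes> a" using u inv_solve_left by (metis S_carrier A_carrier a_in_A)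
          then have "u = a \<otimes> inv y" using a_central[of "inv y"] u by simp
          then have "a \<otimes> y \<in> S" using a_inv[of y] u by simp
          then show ?thesis using no_a True u by blast
        qed (use W u in auto)
      qed
    qed (use out_T sA in auto)
    \<comment> \<open>Otherwise \<open>S\<close> consists of powers of \<open>s\<close>, so the
      centraliser of \<open>s\<close> is the whole group; but \<open>s\<close> inverts an element of
      \<open>A\<close> that is not its own inverse.\<close>
    have "\<exists>x\<in>S. x \<in> A \<and> x \<noteq> a"
    proof (rule ccontr)
      assume n: "\<not> ?thesis"
      let ?K = "{g \<in> carrier G. g \<otimes> s = s \<otimes> g}"
      have "subgroup ?K G"
      proof (rule subgroupI)
        fix g assume "g \<in> ?K"
        then have g: "g \<in> carrier G" "g \<otimes> s = s \<otimes> g" by auto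
        have "inv g \<otimes> s = inv g \<otimes> (s \<otimes> g) \<otimes> inv g" using g by (simp add: m_assoc)
        also have "\<dots> = s \<otimes> inv g" using g(1) unfolding g(2)[symmetric] by (simp add: m_assoc)
        finally show "inv g \<in> ?K" using g by simp
      next
        fix g h assume "g \<in> ?K" "h \<in> ?K"
        then have gh: "g \<in> carrier G" "h \<in> carrier G" "g \<otimes> s = s \<otimes> g" "h \<otimes> s = s \<otimes> h" by auto
        have "g \<otimes> h \<otimes> s = g \<otimes> s \<otimes> h" using gh(1,2,4) by (simp add: m_assoc)
        also have "\<dots> = s \<otimes> g \<otimes> h" by (simp only: gh(3))
        also have "\<dots> = s \<otimes> (g \<otimes> h)" using gh(1,2) by (simp add: m_assoc)
        finally show "g \<otimes> h \<in> ?K" using gh by simp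
      qed (use S_carrier[OF s_in_S] in auto)
      moreover have "S \<subseteq> ?K"
      proof
        fix y assume "y \<in> S"
        then have "y = s \<or> y = inv s \<or> y = a" using n W by blast
        then show "y \<in> ?K" using a_central[of s] by auto
      qed
      ultimately have K: "?K = carrier G" using generating_not_subset by blast
      obtain b where b: "b \<in> A" "b \<noteq> \<one>" "b \<noteq> a" using A_nontrivial by auto
      then have "b \<otimes> s = s \<otimes> b" using K by (metis (mono_tags, lifting) A_carrier mem_Collect_eq)
      then have "b \<otimes> s = inv b \<otimes> s" using s_conj(1)[OF b(1)] by simp
      then have "b = inv b" using b by simp
      then have "b \<otimes> b = \<one>" using b by (metis A_carrier r_inv)
      then show False using A_square_one b by blast
    qed
    then obtain x where x [simp]: "x \<in> S" "x \<in> A" "x \<noteq> a" by blast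
    have mu: "mu = 2" using mu_cases[OF x] no_a[of x] by simp
    \<comment> \<open>Squaring stays inside \<open>S \<inter> A - {a}\<close>: a square
      \<open>a\<close> would make \<open>a \<otimes> y\<close> the inverse of \<open>y\<close>, and
      a square outside \<open>S\<close> would bring \<open>a_mult_in_S\<close> into play. Both put
      \<open>a \<otimes> y\<close> into \<open>S\<close>, against \<open>no_a\<close>.\<close>
    have sq_in: "y \<otimes> y \<in> S \<and> y \<otimes> y \<noteq> a" if y: "y \<in> S" "y \<in> A" "y \<noteq> a" for y
    proof -
      have yy1: "y \<otimes> y \<noteq> \<one>" using A_square_one[of y] y by auto
      have yya: "y \<otimes> y \<noteq> a"
      proof
        assume e: "y \<otimes> y = a"
        have "y \<otimes> (a \<otimes> y) = a \<otimes> (y \<otimes> y)" using y by (simp add: A_lcomm)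
        then have "y \<otimes> (a \<otimes> y) = \<one>" using e a_square by simp
        then have "inv y = a \<otimes> y" using y A_comm[of y "a \<otimes> y"] by (intro inv_equality) auto
        then show False using no_a[of y] S_inv[OF y(1)] y by simp
      qed
      have "y \<otimes> y \<in> S"
      proof (rule ccontr)
        assume nS: "y \<otimes> y \<notin> S"
        have "a \<otimes> y \<in> S"
        proof (rule a_mult_in_S[OF y(1,2)])
          show "card (T (y \<otimes> y)) = 2" using card_T_dist2[of y y] nS yy1 mu y by simp
          show "p \<otimes> q \<noteq> y \<otimes> y" if "p \<in> S - A" "q \<in> S - A" for p q
            using out[OF that] yy1 yya by auto
        qed
        then show False using no_a y by simp
      qed
      then show ?thesis using yya by simp
    qed
    have xx: "x \<otimes> x \<in> S" "x \<otimes> x \<noteq> a" using sq_in[of x] by auto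
    have xxxx: "(x \<otimes> x) \<otimes> (x \<otimes> x) \<in> S" using sq_in[of "x \<otimes> x"] xx by auto
    \<comment> \<open>This makes \<open>lam\<close> nonzero, so \<open>lambda_eq_0\<close> read
      backwards puts \<open>a = s \<otimes> s\<close> into \<open>S\<close>, and \<open>lam\<close>
      can be computed from \<open>T a\<close>.\<close>
    have "x \<in> T (x \<otimes> x)" by (intro T_I) auto
    then have "lam \<noteq> 0" using card_T_adjacent[OF xx(1)] by (metis card_0_eq empty_iff finite_T)
    then have aS: "a \<in> S" using lambda_eq_0 ss by auto
    have lam: "lam = 2" using card_T_adjacent[OF aS] Ta by simp
    let ?z = "(x \<otimes> x) \<otimes> (x \<otimes> x)"
    \<comment> \<open>Unless \<open>x^3\<close> is \<one>, the elements \<open>x\<close>,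
      \<open>x^4\<close> and \<open>x^-2\<close> are three members of
      \<open>T (x \<otimes> x)\<close>. The coincidence \<open>x^4 = x^-2\<close> leaves
      \<open>x^3 = a\<close>, which puts \<open>a \<otimes> inv x\<close> into
      \<open>S\<close>.\<close>
    have cube: "x \<otimes> x = inv x"
    proof (rule ccontr)
      assume n: "x \<otimes> x \<noteq> inv x"
      then have n3: "x \<otimes> (x \<otimes> x) \<noteq> \<one>" by (metis A_carrier A_closed(2) A_comm inv_equality x(2))
      have "x \<noteq> ?z"
      proof
        assume "x = ?z"
        then have "x \<otimes> \<one> = x \<otimes> (x \<otimes> (x \<otimes> x))" by (simp add: m_assoc)
        then have "\<one> = x \<otimes> (x \<otimes> x)" by (subst (asm) l_cancel) auto
        then show False using n3 by simp
      qed
      moreover have "x \<noteq> inv (x \<otimes> x)"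
      proof
        assume "x = inv (x \<otimes> x)"
        then have "x \<otimes> (x \<otimes> x) = \<one>" by (metis A_carrier A_closed(2) l_inv x(2))
        then show False using n3 by simp
      qed
      moreover have "?z \<noteq> inv (x \<otimes> x)"
      proof
        assume "?z = inv (x \<otimes> x)"
        then have "?z \<otimes> (x \<otimes> x) = \<one>" by simp
        then have "(x \<otimes> (x \<otimes> x)) \<otimes> (x \<otimes> (x \<otimes> x)) = \<one>" by (simp add: m_assoc)
        then have "x \<otimes> (x \<otimes> x) = a" using A_square_one[of "x \<otimes> (x \<otimes> x)"] n3 by simp
        then have "inv x \<otimes> a = x \<otimes> x" by (metis A_carrier A_closed(2) inv_mult_cancel(1) x(2))
        then have "a \<otimes> inv x \<in> S" using xx a_central[of "inv x"] by simp
        then show False using no_a[of "inv x"] by simp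
      qed
      ultimately have "card {x, ?z, inv (x \<otimes> x)} = 3" by simp
      moreover have "{x, ?z, inv (x \<otimes> x)} \<subseteq> T (x \<otimes> x)"
      proof -
        have "q \<otimes> q \<otimes> inv q = q" "inv q \<otimes> (q \<otimes> q) = q" if "q \<in> carrier G" for q
          using that by (simp_all add: m_assoc)
        then have "?z \<in> T (x \<otimes> x)" "inv (x \<otimes> x) \<in> T (x \<otimes> x)"
          using T_I[OF xxxx S_inv[OF xx(1)]] T_I[OF S_inv[OF xx(1)] xxxx] by simp_all
        then show ?thesis using \<open>x \<in> T (x \<otimes> x)\<close> by simp
      qed
      ultimately show False
        using card_mono[of "T (x \<otimes> x)" "{x, ?z, inv (x \<otimes> x)}"] card_T_adjacent[OF xx(1)] lam by simp
    qed
    then have icube: "inv x \<otimes> inv x = x" using inv_mult_group[of x x] by simp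
    \<comment> \<open>The square of \<open>inv x\<close> is \<open>x\<close>, a neighbour of \<one>,
      so the two elements required by \<open>a_mult_in_S\<close> come from \<open>lam = 2\<close>
      this time.\<close>
    have "a \<otimes> inv x \<in> S"
    proof (rule a_mult_in_S)
      show "card (T (inv x \<otimes> inv x)) = 2" using card_T_adjacent[of x] lam icube by simp
      show "p \<otimes> q \<noteq> inv x \<otimes> inv x" if "p \<in> S - A" "q \<in> S - A" for p q
        using out[OF that] S_neq_one[OF x(1)] x(3) unfolding icube by (metis empty_iff insert_iff)
    qed simp_all
    then show ?thesis using no_a[of "inv x"] by simp
  qed
qed

end

section \<open>From the parameters to the graph, and from the given data to the locales\<close>

text \<open>\<open>lam = 0\<close> says that \<open>S S\<close> misses \<open>S\<close>. As
  \<open>mu\<close> equals \<open>card S\<close>, every nontrivial product of two elements of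
  \<open>S\<close> has all of \<open>S\<close> as first factors; taking \<open>inv z\<close> as
  first factor gives \<open>S S S\<close> inside \<open>S\<close>.\<close>

lemma (in generalized_dicyclic_minimal) cayley_graph_iso:
  "digraph_iso (with_proj (cayley_graph G S)) (with_proj (complete_bipartite_graph 4 4))"
proof -
  have c: "card S = 4" "lam = 0" "mu = 4"
    using parameters_if_s_in_A parameters_if_s_notin_A by blast+
  have two: "x \<otimes> y \<notin> S" if "x \<in> S" "y \<in> S" for x y
  proof
    assume "x \<otimes> y \<in> S"
    then have "card (T (x \<otimes> y)) = 0" using card_T_adjacent c by simp
    moreover have "x \<in> T (x \<otimes> y)" using that by (intro T_I) auto
    ultimately show False by (metis card_0_eq empty_iff finite_T)
  qed
  have three: "z \<otimes> (x \<otimes> y) \<in> S" if xyz: "x \<in> S" "y \<in> S" "z \<in> S" for x y z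
  proof (cases "x \<otimes> y = \<one>")
    case True
    then show ?thesis using xyz by simp
  next
    case False
    then have "card (T (x \<otimes> y)) = card S" using card_T_dist2 two xyz c by simp
    then have "T (x \<otimes> y) = S" by (intro card_subset_eq) (auto simp: T_def)
    then have "inv z \<in> T (x \<otimes> y)" using xyz by simp
    then obtain u where u: "u \<in> S" "inv z \<otimes> u = x \<otimes> y" by (rule T_E)
    then show ?thesis using xyz unfolding u(2)[symmetric] by simp
  qed
  show ?thesis
    using cayley_graph_complete_bipartite[of S] finite_S S_gen two three s_in_S c(1) S_carrier
    by (metis S_inv empty_iff subsetI)
qed

text \<open>The union of \<open>A\<close> and \<open>t A\<close> is closed under products and
  inverses, so it is the whole group. Each element outside \<open>A\<close> is then some
  \<open>t \<otimes> x\<close>, whose square is \<open>a\<close> and which inverts \<open>A\<close>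
  because \<open>t\<close> does and \<open>A\<close> is abelian.\<close>

lemma generalized_dicyclicI:
  fixes G (structure)
  assumes "group G" and sub: "subgroup A G" and "comm_group (G\<lparr>carrier := A\<rparr>)"
    and fin: "finite A" and card: "card A = 2 * n" "n > 1"
    and inv: "{x \<in> A. group.ord G x = 2} = {a}"
    and t: "t \<in> carrier G" and gen: "generate G (A \<union> {t}) = carrier G"
    and tt: "t \<otimes> t = a" and conj: "\<forall>x\<in>A. inv t \<otimes> x \<otimes> t = inv x"
  shows "generalized_dicyclic G A a"
proof -
  interpret group G by fact
  interpret A: comm_group "G\<lparr>carrier := A\<rparr>" by fact
  interpret A: subgroup A G by fact
  have A_comm: "x \<otimes> y = y \<otimes> x" if "x \<in> A" "y \<in> A" for x y
    using A.m_comm[of x y] that by simp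
  have ord2: "ord x = 2 \<longleftrightarrow> x \<otimes> x = \<one> \<and> x \<noteq> \<one>" if x: "x \<in> A" for x
  proof -
    have "x [^] (2::nat) = x \<otimes> x" using x by (simp add: numeral_2_eq_2)
    then have "x \<otimes> x = \<one> \<longleftrightarrow> ord x dvd 2" using pow_eq_id[of x 2] x by simp
    also have "\<dots> \<longleftrightarrow> ord x = 1 \<or> ord x = 2"
      by (metis dvd_refl one_dvd prime_nat_iff two_is_prime_nat)
    finally show ?thesis using ord_eq_1[of x] x by auto
  qed
  have aA: "a \<in> A" and a: "a \<otimes> a = \<one>" "a \<noteq> \<one>" using inv ord2[of a] by auto
  have sq1: "x = \<one> \<or> x = a" if "x \<in> A" "x \<otimes> x = \<one>" for x using ord2[of x] inv that by blast
  have "\<not> A \<subseteq> {\<one>, a}"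
  proof
    assume "A \<subseteq> {\<one>, a}"
    then have "card A \<le> card {\<one>, a}" by (intro card_mono) auto
    also have "\<dots> \<le> 2" by (simp add: card_insert_if)
    finally show False using card by simp
  qed
  then obtain b where b: "b \<in> A" "b \<noteq> \<one>" "b \<noteq> a" by blast
  \<comment> \<open>If \<open>t\<close> were in \<open>A\<close>, it would centralise
    \<open>b\<close> as well as invert it, making \<open>b\<close> a square root of \<one>.\<close>
  have tA: "t \<notin> A"
  proof
    assume "t \<in> A"
    then have "inv t \<otimes> b \<otimes> t = b" using A_comm[of b t] b t by (simp add: m_assoc) (simp flip: m_assoc)
    then have "inv b = b" using conj b by simp
    then have "b \<otimes> b = \<one>" using r_inv[of b] b by simp
    then show False using sq1 b by blast
  qed
  have tx: "t \<otimes> x = inv x \<otimes> t" if x: "x \<in> A" for x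
  proof -
    have "t \<otimes> (inv t \<otimes> inv x \<otimes> t) = inv x \<otimes> t" using x t by (simp flip: m_assoc)
    then show ?thesis using conj x by simp
  qed
  have xt: "x \<otimes> t = t \<otimes> inv x" if x: "x \<in> A" for x
    using tx[of "inv x"] x by simp
  have inv_t: "inv t = t \<otimes> a" using a t tt aA by (intro inv_equality[symmetric] inv_unique'[symmetric]) (auto simp flip: m_assoc)
  have txty: "(t \<otimes> x) \<otimes> (t \<otimes> y) = a \<otimes> (inv x \<otimes> y)" if "x \<in> A" "y \<in> A" for x y
  proof -
    have "(t \<otimes> x) \<otimes> (t \<otimes> y) = t \<otimes> (x \<otimes> t) \<otimes> y" using that t by (simp add: m_assoc)
    also have "\<dots> = (t \<otimes> t) \<otimes> (inv x \<otimes> y)" using that t by (simp add: xt m_assoc)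
    finally show ?thesis by (simp add: tt)
  qed
  let ?K = "A \<union> (\<lambda>x. t \<otimes> x) ` A"
  have "subgroup ?K G"
  proof (rule subgroupI)
    show "?K \<subseteq> carrier G" using t by auto
    show "?K \<noteq> {}" using aA by blast
    fix g assume g: "g \<in> ?K"
    have "inv (t \<otimes> x) \<in> ?K" if "x \<in> A" for x
    proof -
      have "inv (t \<otimes> x) = (inv x \<otimes> t) \<otimes> a" using that t aA by (simp add: inv_mult_group inv_t m_assoc)
      also have "\<dots> = t \<otimes> (x \<otimes> a)" using that t aA by (simp add: xt m_assoc)
      finally show ?thesis using that aA by auto
    qed
    then show "inv g \<in> ?K" using g by auto
    fix h assume h: "h \<in> ?K"
    have 1: "x \<otimes> (t \<otimes> y) \<in> ?K" if "x \<in> A" "y \<in> A" for x y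
    proof -
      have "x \<otimes> (t \<otimes> y) = (x \<otimes> t) \<otimes> y" using that t by (simp add: m_assoc)
      also have "\<dots> = t \<otimes> (inv x \<otimes> y)" using that t by (simp add: xt m_assoc)
      finally show ?thesis using that by auto
    qed
    have 2: "(t \<otimes> x) \<otimes> y \<in> ?K" if "x \<in> A" "y \<in> A" for x y
      using that t by (simp add: m_assoc)
    have 3: "(t \<otimes> x) \<otimes> (t \<otimes> y) \<in> ?K" if "x \<in> A" "y \<in> A" for x y
      using that aA by (simp add: txty)
    have 4: "x \<otimes> y \<in> ?K" if "x \<in> A" "y \<in> A" for x y
      using that by simp
    have "g \<in> A \<or> (\<exists>x\<in>A. g = t \<otimes> x)" "h \<in> A \<or> (\<exists>x\<in>A. h = t \<otimes> x)" using g h by auto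
    then show "g \<otimes> h \<in> ?K" by (elim disjE bexE) (simp_all only: 1 2 3 4)
  qed
  moreover have "A \<union> {t} \<subseteq> ?K"
  proof -
    have "t = t \<otimes> \<one>" using t by simp
    then have "t \<in> (\<lambda>x. t \<otimes> x) ` A" using A.one_closed by (rule image_eqI)
    then show ?thesis by simp
  qed
  ultimately have K: "carrier G = ?K"
    using generate_subgroup_incl[of "A \<union> {t}" ?K] gen subgroup.subset[of ?K G] by auto
  have out: "\<exists>x\<in>A. g = t \<otimes> x" if "g \<in> carrier G - A" for g using that K by auto
  show ?thesis
  proof unfold_locales
    show "A \<noteq> carrier G" using tA t by blast
    show "finite (carrier G)" using K fin by simp
    show "\<exists>b\<in>A. b \<notin> {\<one>, a}" using b by blast
    fix g assume g: "g \<in> carrier G - A"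
    obtain x where x: "x \<in> A" "g = t \<otimes> x" using out[OF g] by blast
    show "g \<otimes> g = a" using x aA by (simp add: txty)
    show "g \<otimes> y = inv y \<otimes> g" if y: "y \<in> A" for y
    proof -
      have "g \<otimes> y = t \<otimes> (y \<otimes> x)" using x y t A_comm[of x y] by (simp add: m_assoc)
      also have "\<dots> = t \<otimes> y \<otimes> x" using x y t by (simp add: m_assoc)
      also have "\<dots> = inv y \<otimes> g" using x y t by (simp add: tx m_assoc)
      finally show ?thesis .
    qed
  qed (use sub A_comm aA a sq1 in auto)
qed

theorem theorem1p1:
  fixes G :: "('g, 'm) monoid_scheme" (structure)
    and A S :: "'g set" and a t :: 'g and n :: nat
  assumes "group G"
    and "subgroup A G"
    and "comm_group (G\<lparr>carrier := A\<rparr>)"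
    and "finite A"
    and "card A = 2 * n"
    and "n > 1"
    and "{x \<in> A. group.ord G x = 2} = {a}"
    and "t \<in> carrier G"
    and "generate G (A \<union> {t}) = carrier G"
    and "t \<otimes> t = a"
    and "\<forall>x\<in>A. inv t \<otimes> x \<otimes> t = inv x"
    and "S \<subseteq> carrier G - {\<one>}"
    and "\<forall>s\<in>S. inv s \<in> S"
    and "generate G S = carrier G"
    and "\<exists>s\<in>S. generate G (S - {s, inv s}) \<noteq> carrier G"
  shows "distance_regular (with_proj (cayley_graph G S)) \<longleftrightarrow>
    digraph_iso (with_proj (cayley_graph G S)) (with_proj (complete_bipartite_graph 4 4))"
proof
  interpret generalized_dicyclic G A a
    by (rule generalized_dicyclicI[OF assms(1-11)])
  assume dr: "distance_regular (with_proj (cayley_graph G S))"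
  obtain l m :: nat
    where l: "\<And>x. x \<in> S \<Longrightarrow> card {y \<in> S. \<exists>u\<in>S. y \<otimes> u = x} = l"
      and m: "\<And>x y. x \<in> S \<Longrightarrow> y \<in> S \<Longrightarrow> x \<otimes> y \<notin> S \<Longrightarrow> x \<otimes> y \<noteq> \<one> \<Longrightarrow>
        card {v \<in> S. \<exists>u\<in>S. v \<otimes> u = x \<otimes> y} = m"
    using cayley_graph_distance_regular_common_neighbours[OF finite_carrier assms(12) _ dr] assms(13)
    by blast
  obtain s where s: "s \<in> S" "generate G (S - {s, inv s}) \<noteq> carrier G" using assms(15) by blast
  define H where "H = generate G (S - {s, inv s})"
  have H: "subgroup H G" using assms(12) unfolding H_def by (intro generate_is_subgroup) auto
  have sub: "S - {s, inv s} \<subseteq> H" unfolding H_def by (auto intro: generate.incl)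
  \<comment> \<open>With \<open>s\<close> the subgroup would also contain \<open>inv s\<close>,
    hence all of \<open>S\<close>, and would not be proper.\<close>
  have "s \<notin> H"
  proof
    assume "s \<in> H"
    then have "S \<subseteq> H" using sub subgroup.m_inv_closed[OF H] by auto
    then have "carrier G \<subseteq> H" using generate_subgroup_incl[of S H] H assms(14) by simp
    then show False using s(2) subgroup.subset[OF H] by (simp add: H_def)
  qed
  then interpret generalized_dicyclic_minimal G A a S H s l m "\<lambda>z. {y \<in> S. \<exists>u\<in>S. y \<otimes> u = z}"
    using assms(12-14) s(1) sub l m
    by unfold_locales (auto intro: subgroup.m_closed[OF H] subgroup.one_closed[OF H]
      subgroup.m_inv_closed[OF H] subgroup.mem_carrier[OF H])
  show "digraph_iso (with_proj (cayley_graph G S)) (with_proj (complete_bipartite_graph 4 4))"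
    by (rule cayley_graph_iso)
next
  assume "digraph_iso (with_proj (cayley_graph G S)) (with_proj (complete_bipartite_graph 4 4))"
  then obtain P Q where "finite P" "finite Q" "card P = 4" "card Q = 4" "P \<inter> Q = {}"
      "pverts (cayley_graph G S) = P \<union> Q" "parcs (cayley_graph G S) = P \<times> Q \<union> Q \<times> P"
    unfolding digraph_iso_complete_bipartite_iff by blast
  then show "distance_regular (with_proj (cayley_graph G S))"
    by (intro distance_regular_complete_bipartite[of P Q 4]) auto
qed

end
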